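(* Let $T$ be a tree and let $G \le \mathrm{Aut}(T)$ be closed, locally compact and act geometrically densely on $T$. Then $G^{++}$ is trivial or simple as an abstract group.
   Context: $\mathrm{Aut}(T)$ carries the permutation topology (pointwise convergence on the vertex set, which is regarded as discrete), and $G$ is a closed subgroup which is locally compact in the induced topology. Trees need not be locally finite. A group acting by automorphisms on a tree $T$ is geometrically dense if it fixes no end of $T$ and preserves no proper (non-empty) subtree of $T$. A half-tree of $T$ is one of the two connected components obtained by removing an edge from $T$. For a half-tree $Y$, the rigid stabiliser $\mathrm{rist}_G(Y)$ is the subgroup of elements of $G$ that fix pointwise all vertices outside $Y$. $G^{++}$ is the subgroup of $G$ (abstractly) generated by the rigid stabilisers $\mathrm{rist}_G(Y)$ of all half-trees $Y$ of $T$. *)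

theory Defs
  imports
    "HOL-Analysis.Abstract_Topological_Spaces"
    "HOL-Analysis.Function_Topology"
    "HOL-Algebra.Bij"
    "HOL-Algebra.Generated_Groups"
begin

section \<open>Trees\<close>

text \<open>
  A simple graph is a vertex set \<open>V\<close> with a symmetric irreflexive relation \<open>E\<close> on \<open>V\<close>;
  an undirected edge is represented by its two orientations. No finiteness is required.
\<close>

definition is_graph :: "'v set \<Rightarrow> ('v \<times> 'v) set \<Rightarrow> bool" where
  "is_graph V E \<longleftrightarrow> E \<subseteq> V \<times> V \<and> sym E \<and> irrefl E"

definition components :: "'v set \<Rightarrow> ('v \<times> 'v) set \<Rightarrow> 'v set set" where
  "components V E = {{w \<in> V. (v, w) \<in> E\<^sup>*} |v. v \<in> V}"

definition is_cycle :: "('v \<times> 'v) set \<Rightarrow> 'v list \<Rightarrow> bool" where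
  "is_cycle E xs \<longleftrightarrow> 3 \<le> length xs \<and> distinct xs \<and>
     (\<forall>i < length xs. (xs ! i, xs ! (Suc i mod length xs)) \<in> E)"

definition is_tree :: "'v set \<Rightarrow> ('v \<times> 'v) set \<Rightarrow> bool" where
  "is_tree V E \<longleftrightarrow> is_graph V E \<and> V \<noteq> {} \<and>
     (\<forall>x \<in> V. \<forall>y \<in> V. (x, y) \<in> E\<^sup>*) \<and> \<not> (\<exists>xs. is_cycle E xs)"

definition is_subtree :: "'v set \<Rightarrow> ('v \<times> 'v) set \<Rightarrow> 'v set \<Rightarrow> ('v \<times> 'v) set \<Rightarrow> bool" where
  "is_subtree W F V E \<longleftrightarrow> is_tree W F \<and> W \<subseteq> V \<and> F \<subseteq> E"

text \<open>A half-tree is identified with its set of vertices.\<close>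

definition half_trees :: "'v set \<Rightarrow> ('v \<times> 'v) set \<Rightarrow> 'v set set" where
  "half_trees V E = (\<Union>(x, y) \<in> E. components V (E - {(x, y), (y, x)}))"

definition rays :: "('v \<times> 'v) set \<Rightarrow> (nat \<Rightarrow> 'v) set" where
  "rays E = {r. inj r \<and> (\<forall>n. (r n, r (Suc n)) \<in> E)}"

text \<open>In a tree, two rays define the same end iff they have a common tail.\<close>

definition cofinal_rays :: "('v \<times> 'v) set \<Rightarrow> ((nat \<Rightarrow> 'v) \<times> (nat \<Rightarrow> 'v)) set" where
  "cofinal_rays E = {(r, s). r \<in> rays E \<and> s \<in> rays E \<and> (\<exists>m n. \<forall>k. r (m + k) = s (n + k))}"

definition tree_ends :: "('v \<times> 'v) set \<Rightarrow> (nat \<Rightarrow> 'v) set set" where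
  "tree_ends E = rays E // cofinal_rays E"


section \<open>The automorphism group and its permutation topology\<close>

text \<open>
  As in \<^const>\<open>Bij\<close>, automorphisms are extensional functions on \<open>V\<close>. Edge inversions are allowed.
\<close>

definition tree_auts :: "'v set \<Rightarrow> ('v \<times> 'v) set \<Rightarrow> ('v \<Rightarrow> 'v) set" where
  "tree_auts V E = {g \<in> Bij V. \<forall>x \<in> V. \<forall>y \<in> V. (g x, g y) \<in> E \<longleftrightarrow> (x, y) \<in> E}"

definition Aut_tree :: "'v set \<Rightarrow> ('v \<times> 'v) set \<Rightarrow> ('v \<Rightarrow> 'v) monoid" where
  "Aut_tree V E = (BijGroup V)\<lparr>carrier := tree_auts V E\<rparr>"

definition perm_topology :: "'v set \<Rightarrow> ('v \<times> 'v) set \<Rightarrow> ('v \<Rightarrow> 'v) topology" where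
  "perm_topology V E =
     subtopology (product_topology (\<lambda>_. discrete_topology V) V) (tree_auts V E)"


section \<open>Geometric density, rigid stabilisers, and the group they generate\<close>

definition fixes_end :: "('v \<Rightarrow> 'v) set \<Rightarrow> (nat \<Rightarrow> 'v) set \<Rightarrow> bool" where
  "fixes_end G \<xi> \<longleftrightarrow> (\<forall>g \<in> G. (\<lambda>r. g \<circ> r) ` \<xi> = \<xi>)"

definition preserves_subtree :: "('v \<Rightarrow> 'v) set \<Rightarrow> 'v set \<Rightarrow> ('v \<times> 'v) set \<Rightarrow> bool" where
  "preserves_subtree G W F \<longleftrightarrow> (\<forall>g \<in> G. g ` W = W \<and> map_prod g g ` F = F)"

definition geometrically_dense :: "'v set \<Rightarrow> ('v \<times> 'v) set \<Rightarrow> ('v \<Rightarrow> 'v) set \<Rightarrow> bool" where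
  "geometrically_dense V E G \<longleftrightarrow>
     \<not> (\<exists>\<xi> \<in> tree_ends E. fixes_end G \<xi>) \<and>
     \<not> (\<exists>W F. is_subtree W F V E \<and> (W, F) \<noteq> (V, E) \<and> preserves_subtree G W F)"

definition rist :: "'v set \<Rightarrow> ('v \<Rightarrow> 'v) set \<Rightarrow> 'v set \<Rightarrow> ('v \<Rightarrow> 'v) set" where
  "rist V G Y = {g \<in> G. \<forall>v \<in> V - Y. g v = v}"

definition plus_plus :: "'v set \<Rightarrow> ('v \<times> 'v) set \<Rightarrow> ('v \<Rightarrow> 'v) set \<Rightarrow> ('v \<Rightarrow> 'v) set" where
  "plus_plus V E G = generate (Aut_tree V E) (\<Union>Y \<in> half_trees V E. rist V G Y)"

text \<open>
  The locale \<open>simple_group\<close> of \<open>HOL-Algebra\<close> requires \<open>order K > 1\<close>, which excludes infinite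
  groups because \<^const>\<open>card\<close> is 0 on infinite sets; hence the following definition.
\<close>

definition abstractly_simple :: "('a, 'b) monoid_scheme \<Rightarrow> bool" where
  "abstractly_simple K \<longleftrightarrow> group K \<and> carrier K \<noteq> {\<one>\<^bsub>K\<^esub>} \<and>
     (\<forall>N. N \<lhd> K \<longrightarrow> N = carrier K \<or> N = {\<one>\<^bsub>K\<^esub>})"


section \<open>Basic facts\<close>

lemma subgroup_tree_auts: "subgroup (tree_auts V E) (BijGroup V)"
proof -
  interpret B: group "BijGroup V" by (rule group_BijGroup)
  show ?thesis
  proof (rule B.subgroupI)
    show "tree_auts V E \<subseteq> carrier (BijGroup V)"
      by (auto simp: tree_auts_def BijGroup_def)
    have "(\<lambda>x \<in> V. x) \<in> tree_auts V E"
      by (auto simp: tree_auts_def id_Bij)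
    then show "tree_auts V E \<noteq> {}" by blast
  next
    fix g assume g: "g \<in> tree_auts V E"
    then have gB: "g \<in> Bij V" by (simp add: tree_auts_def)
    then have b: "bij_betw g V V" by (simp add: Bij_def)
    have "restrict (inv_into V g) V \<in> tree_auts V E"
      unfolding tree_auts_def
    proof (intro CollectI conjI ballI)
      show "restrict (inv_into V g) V \<in> Bij V" by (rule restrict_inv_into_Bij[OF gB])
      fix x y assume xy: "x \<in> V" "y \<in> V"
      have "inv_into V g x \<in> V" "inv_into V g y \<in> V"
        using xy gB by (simp_all add: Bij_inv_into_mem)
      moreover have "g (inv_into V g x) = x" "g (inv_into V g y) = y"
        using xy b by (simp_all add: bij_betw_inv_into_right)
      ultimately show "(restrict (inv_into V g) V x, restrict (inv_into V g) V y) \<in> E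
          \<longleftrightarrow> (x, y) \<in> E"
        using g xy unfolding tree_auts_def by force
    qed
    then show "inv\<^bsub>BijGroup V\<^esub> g \<in> tree_auts V E" by (simp add: inv_BijGroup gB)
  next
    fix g h assume gh: "g \<in> tree_auts V E" "h \<in> tree_auts V E"
    then have B: "g \<in> Bij V" "h \<in> Bij V" by (simp_all add: tree_auts_def)
    then have "h x \<in> V" if "x \<in> V" for x
      using that Bij_imp_funcset by blast
    then have "compose V g h \<in> tree_auts V E"
      using gh B by (auto simp: tree_auts_def compose_Bij compose_eq)
    then show "g \<otimes>\<^bsub>BijGroup V\<^esub> h \<in> tree_auts V E" using B by (simp add: BijGroup_def)
  qed
qed

lemma group_Aut_tree: "group (Aut_tree V E)"
  unfolding Aut_tree_def
  by (rule subgroup.subgroup_is_group[OF subgroup_tree_auts group_BijGroup])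

lemma topspace_perm_topology: "topspace (perm_topology V E) = tree_auts V E"
  by (auto simp: perm_topology_def tree_auts_def Bij_def PiE_def bij_betw_def)

end

theory Submission
  imports Defs
begin

text \<open>
  The argument is that of Tits. Normality passes geometric density from \<open>G\<close> to \<open>G\<^sup>+\<^sup>+\<close> and then to
  any nontrivial normal subgroup \<open>N\<close> of \<open>G\<^sup>+\<^sup>+\<close>, unless no vertex has three neighbours, in which case
  rigid stabilisers are trivial. Under a geometrically dense action every half-tree can be moved
  into any other, so for each half-tree \<open>Y\<close> there are \<open>n \<in> N\<close> and a half-tree \<open>Z \<supseteq> Y\<close> with
  \<open>n Z \<subseteq> Z - Y\<close>. The translates \<open>n\<^sup>k Y\<close> are then disjoint subsets of \<open>Z\<close>, and for \<open>a \<in> rist(Y)\<close> the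
  infinite product \<open>b\<close> of the \<open>n\<^sup>k a n\<^sup>-\<^sup>k\<close> over \<open>k \<ge> 0\<close> lies in the closed group \<open>G\<close>, hence in
  \<open>rist(Z) \<subseteq> G\<^sup>+\<^sup>+\<close>. Therefore \<open>a = b n b\<^sup>-\<^sup>1 n\<^sup>-\<^sup>1\<close> is in \<open>N\<close>.
\<close>

section \<open>Half-trees and convex sets\<close>

text \<open>The walk grows one edge at a time and is cut back to the earlier occurrence whenever its
  new endpoint repeats a vertex. The distinct list is what \<open>is_cycle\<close> demands in
  \<open>notin_hs\<close>.\<close>

lemma rtrancl_distinct_path:
  assumes "(a, b) \<in> R\<^sup>*"
  shows "\<exists>xs. xs \<noteq> [] \<and> distinct xs \<and> hd xs = a \<and> last xs = b \<and>
    (\<forall>i. Suc i < length xs \<longrightarrow> (xs ! i, xs ! Suc i) \<in> R)"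
  using assms
proof (induction rule: rtrancl_induct)
  case base
  show ?case by (rule exI[of _ "[a]"]) auto
next
  case (step b c)
  then obtain xs where xs: "xs \<noteq> []" "distinct xs" "hd xs = a" "last xs = b"
    "\<And>i. Suc i < length xs \<Longrightarrow> (xs ! i, xs ! Suc i) \<in> R" by blast
  show ?case
  proof (cases "c \<in> set xs")
    case True
    then obtain j where j: "j < length xs" "xs ! j = c" by (auto simp: in_set_conv_nth)
    have "length (take (Suc j) xs) = Suc j" using j by simp
    then have "last (take (Suc j) xs) = c" using j by (subst last_conv_nth) auto
    then show ?thesis
      using xs j by (intro exI[of _ "take (Suc j) xs"]) (auto simp: hd_take)
  next
    case False
    have "(xs @ [c]) ! i = b" if "i < length xs" "Suc i = length xs" for i
    proof -
      have "i = length xs - 1" using that by simp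
      then show ?thesis using that xs(1,4) by (simp add: nth_append last_conv_nth)
    qed
    then show ?thesis
      using xs False step.hyps
      by (intro exI[of _ "xs @ [c]"]) (auto simp: nth_append less_Suc_eq split: if_splits)
  qed
qed

locale tree =
  fixes V :: "'v set" and E :: "('v \<times> 'v) set"
  assumes tree: "is_tree V E"
begin

text \<open>Half-trees are indexed by oriented edges: this is the side of the head \<open>y\<close>,
  and reversing the edge gives the complement (\<open>hs_compl\<close>).\<close>

definition hs :: "'v \<Rightarrow> 'v \<Rightarrow> 'v set" where
  "hs x y = {w \<in> V. (y, w) \<in> (E - {(x, y), (y, x)})\<^sup>*}"

lemma edge_V: "(x, y) \<in> E \<Longrightarrow> x \<in> V \<and> y \<in> V"
  using tree by (auto simp: is_tree_def is_graph_def)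

lemma edge_sym: "(x, y) \<in> E \<Longrightarrow> (y, x) \<in> E"
  using tree by (auto simp: is_tree_def is_graph_def dest: symD)

lemma edge_neq: "(x, y) \<in> E \<Longrightarrow> x \<noteq> y"
  using tree by (auto simp: is_tree_def is_graph_def irrefl_def)

lemma connected: "x \<in> V \<Longrightarrow> y \<in> V \<Longrightarrow> (x, y) \<in> E\<^sup>*"
  using tree by (auto simp: is_tree_def)

lemma hs_subset: "hs x y \<subseteq> V"
  by (auto simp: hs_def)

lemma in_hs: "(x, y) \<in> E \<Longrightarrow> y \<in> hs x y"
  by (auto simp: hs_def edge_V)

text \<open>Acyclicity enters here. A repetition-free path from \<open>y\<close> to \<open>x\<close>
  off the edge cannot have one vertex, since \<open>x\<close> and \<open>y\<close> differ, nor two,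
  since its only step would be the removed edge; so the edge closes it up to a cycle.\<close>

lemma notin_hs:
  assumes "(x, y) \<in> E"
  shows "x \<notin> hs x y"
proof
  assume "x \<in> hs x y"
  then have "(y, x) \<in> (E - {(x, y), (y, x)})\<^sup>*" by (simp add: hs_def)
  from rtrancl_distinct_path[OF this] obtain xs where
    xs: "xs \<noteq> []" "distinct xs" "hd xs = y" "last xs = x"
    "\<And>i. Suc i < length xs \<Longrightarrow> (xs ! i, xs ! Suc i) \<in> E - {(x, y), (y, x)}" by blast
  have x0: "xs ! 0 = y" using xs by (simp add: hd_conv_nth)
  have xl: "xs ! (length xs - 1) = x" using xs by (simp add: last_conv_nth)
  have "length xs \<noteq> 0" using xs by simp
  moreover have "length xs \<noteq> 1" using x0 xl edge_neq[OF assms] by auto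
  moreover have "length xs \<noteq> 2" using x0 xl xs(5)[of 0] by auto
  ultimately have len: "3 \<le> length xs" by linarith
  have "(xs ! i, xs ! (Suc i mod length xs)) \<in> E" if "i < length xs" for i
  proof (cases "Suc i < length xs")
    case True
    then show ?thesis using xs(5) by auto
  next
    case False
    then have "i = length xs - 1" "Suc i = length xs" using that by auto
    then show ?thesis using x0 xl assms by simp
  qed
  then have "is_cycle E xs" using len xs by (simp add: is_cycle_def)
  then show False using tree by (auto simp: is_tree_def)
qed

lemma hs_step: "u \<in> hs x y \<Longrightarrow> (u, w) \<in> E \<Longrightarrow> w \<in> hs x y \<or> (u, w) = (x, y) \<or> (u, w) = (y, x)"
  by (auto simp: hs_def edge_V intro: rtrancl_into_rtrancl)

lemma hs_exit: "(x, y) \<in> E \<Longrightarrow> u \<in> hs x y \<Longrightarrow> (u, w) \<in> E \<Longrightarrow> w \<in> hs x y \<or> u = y \<and> w = x"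
  using hs_step[of u x y w] notin_hs[of x y] by auto

lemma hs_cover:
  assumes "(x, y) \<in> E" "w \<in> V"
  shows "w \<in> hs x y \<or> w \<in> hs y x"
proof -
  have "(x, w) \<in> E\<^sup>*" using connected assms edge_V by blast
  then show ?thesis
  proof (induction rule: rtrancl_induct)
    case base
    show ?case using in_hs edge_sym assms by blast
  next
    case (step u w)
    then show ?case using hs_step in_hs edge_sym assms by (metis prod.inject)
  qed
qed

lemma hs_disjoint:
  assumes "(x, y) \<in> E"
  shows "hs x y \<inter> hs y x = {}"
proof (rule ccontr)
  assume "hs x y \<inter> hs y x \<noteq> {}"
  then obtain w where w: "(y, w) \<in> (E - {(x, y), (y, x)})\<^sup>*" "(x, w) \<in> (E - {(y, x), (x, y)})\<^sup>*"
    by (auto simp: hs_def)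
  have "sym (E - {(x, y), (y, x)})" using edge_sym by (auto simp: sym_def)
  then have "(w, x) \<in> (E - {(x, y), (y, x)})\<^sup>*"
    using w(2) by (metis insert_commute symD sym_rtrancl)
  with w(1) have "x \<in> hs x y" using assms edge_V by (auto simp: hs_def)
  then show False using notin_hs assms by blast
qed

lemma hs_compl: "(x, y) \<in> E \<Longrightarrow> V - hs x y = hs y x"
  using hs_cover hs_disjoint hs_subset by blast

lemma half_trees_eq: "half_trees V E = {hs x y |x y. (x, y) \<in> E}"
proof -
  have comp: "components V (E - {(x, y), (y, x)}) = {hs x y, hs y x}" if e: "(x, y) \<in> E" for x y
  proof -
    let ?R = "E - {(x, y), (y, x)}"
    have R: "?R = E - {(y, x), (x, y)}" by blast
    have sy: "sym (?R\<^sup>*)" using edge_sym by (intro sym_rtrancl) (auto simp: sym_def)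
    have eq: "{w \<in> V. (v, w) \<in> ?R\<^sup>*} = hs a b"
      if "v \<in> hs a b" "E - {(a, b), (b, a)} = ?R" for v a b
      using that sy unfolding hs_def by (auto dest: symD intro: rtrancl_trans)
    show ?thesis
    proof
      show "components V ?R \<subseteq> {hs x y, hs y x}"
        using hs_cover[OF e] eq[of _ x y] eq[of _ y x] R unfolding components_def by blast
      show "{hs x y, hs y x} \<subseteq> components V ?R"
        using eq[OF in_hs[OF e]] eq[OF in_hs[OF edge_sym[OF e]]] R edge_V[OF e]
        unfolding components_def by blast
    qed
  qed
  show ?thesis
    unfolding half_trees_def using comp edge_sym by (auto, blast+)
qed

lemma half_tree_hs: "(x, y) \<in> E \<Longrightarrow> hs x y \<in> half_trees V E"
  using half_trees_eq by auto

lemma half_treeE: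
  assumes "Y \<in> half_trees V E"
  obtains x y where "(x, y) \<in> E" "Y = hs x y"
  using assms half_trees_eq by auto

lemma half_tree_compl: "Y \<in> half_trees V E \<Longrightarrow> V - Y \<in> half_trees V E"
  using hs_compl edge_sym unfolding half_trees_eq by blast

lemma half_tree_subset: "Y \<in> half_trees V E \<Longrightarrow> Y \<subseteq> V"
  using hs_subset unfolding half_trees_eq by blast

lemma half_tree_proper: "Y \<in> half_trees V E \<Longrightarrow> Y \<noteq> V"
  using edge_V notin_hs unfolding half_trees_eq by blast

lemma half_tree_nonempty: "Y \<in> half_trees V E \<Longrightarrow> Y \<noteq> {}"
  using in_hs unfolding half_trees_eq by blast

text \<open>A walk from \<open>w'\<close> inside its own branch never meets \<open>v\<close>, and
  \<open>v\<close> is the only door into the branch at \<open>w\<close>.\<close>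

lemma hs_neighbour_disjoint:
  assumes "(v, w) \<in> E" "(v, w') \<in> E" "w \<noteq> w'"
  shows "hs v w \<inter> hs v w' = {}"
proof (rule ccontr)
  assume "hs v w \<inter> hs v w' \<noteq> {}"
  then obtain z where z: "z \<in> hs v w" "(w', z) \<in> (E - {(v, w'), (w', v)})\<^sup>*"
    by (auto simp: hs_def)
  have inv: "z \<in> hs v w' \<and> z \<notin> hs v w"
    using z(2)
  proof (induction rule: rtrancl_induct)
    case base
    have "w' \<notin> hs v w"
      using hs_exit[OF assms(1) _ edge_sym[OF assms(2)]] assms notin_hs by blast
    then show ?case using in_hs assms by blast
  next
    case (step a b)
    then have ab: "(a, b) \<in> E" by blast
    have "b \<in> hs v w'" using step hs_step[of a v w' b] by blast
    moreover have "b \<notin> hs v w"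
    proof
      assume "b \<in> hs v w"
      then have "a = v" using hs_exit[OF assms(1) _ edge_sym[OF ab]] step.IH by blast
      then show False using step.IH notin_hs assms by blast
    qed
    ultimately show ?case by blast
  qed
  then show False using z by blast
qed

text \<open>Along a walk starting at \<open>v\<close>, the branch at \<open>v\<close> that contains
  the current vertex can change only when the walk returns to \<open>v\<close>.\<close>

lemma toward:
  assumes "v \<in> V" "u \<in> V" "u \<noteq> v"
  obtains w where "(v, w) \<in> E" "u \<in> hs v w"
proof -
  have "(v, u) \<in> E\<^sup>*" using connected assms by blast
  then have "u = v \<or> (\<exists>w. (v, w) \<in> E \<and> u \<in> hs v w)"
  proof (induction rule: rtrancl_induct)
    case base
    show ?case by simp
  next
    case (step a b)
    then show ?case using in_hs hs_exit by metis
  qed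
  then show thesis using assms that by blast
qed

text \<open>
  The vertex sets of subtrees, described by their boundary edges: this form makes intersections
  of convex sets trivially convex.
\<close>

definition conv :: "'v set \<Rightarrow> bool" where
  "conv W \<longleftrightarrow> W \<subseteq> V \<and> (\<forall>u p. u \<in> W \<longrightarrow> p \<notin> W \<longrightarrow> (u, p) \<in> E \<longrightarrow> W \<subseteq> hs p u)"

lemma conv_Inter: "(\<And>W. W \<in> \<W> \<Longrightarrow> conv W) \<Longrightarrow> conv (V \<inter> \<Inter>\<W>)"
  unfolding conv_def using edge_V by blast

lemma conv_half_tree: "Y \<in> half_trees V E \<Longrightarrow> conv Y"
  using hs_exit hs_subset unfolding conv_def half_trees_eq by blast

text \<open>The walk has to enter \<open>hs p u\<close> at \<open>u\<close>; dropping everything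
  before the entry leaves a strictly shorter walk. This is the descent behind
  \<open>conv_connected\<close>.\<close>

lemma hs_reenter:
  assumes e: "(p, u) \<in> E"
  shows "(a, v) \<in> E ^^ k \<Longrightarrow> a \<notin> hs p u \<Longrightarrow> v \<in> hs p u \<Longrightarrow> \<exists>m<k. (u, v) \<in> E ^^ m"
proof (induction k arbitrary: a)
  case 0
  then show ?case by simp
next
  case (Suc k)
  then obtain b where b: "(a, b) \<in> E" "(b, v) \<in> E ^^ k" by (meson relpow_Suc_D2)
  show ?case
  proof (cases "b \<in> hs p u")
    case True
    then have "b = u" using hs_exit[OF e True edge_sym[OF b(1)]] Suc.prems by blast
    then show ?thesis using b by blast
  next
    case False
    then show ?thesis using Suc.IH[OF b(2)] Suc.prems by (meson less_SucI)
  qed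
qed

text \<open>Strong induction on the length of a walk. If its first step leaves \<open>W\<close>,
  convexity keeps \<open>v\<close> on the side of \<open>u\<close>, so the walk must return through
  \<open>u\<close> and the detour can be deleted.\<close>

lemma conv_connected:
  assumes W: "conv W" and "u \<in> W" "v \<in> W"
  shows "(u, v) \<in> (E \<inter> W \<times> W)\<^sup>*"
proof -
  have "(u, v) \<in> E ^^ n \<Longrightarrow> u \<in> W \<Longrightarrow> (u, v) \<in> (E \<inter> W \<times> W)\<^sup>*" for n u
  proof (induction n arbitrary: u rule: less_induct)
    case (less n)
    show ?case
    proof (cases n)
      case 0
      then show ?thesis using less.prems by simp
    next
      case (Suc k)
      then obtain p where p: "(u, p) \<in> E" "(p, v) \<in> E ^^ k"
        using less.prems by (meson relpow_Suc_D2)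
      show ?thesis
      proof (cases "p \<in> W")
        case True
        then have "(p, v) \<in> (E \<inter> W \<times> W)\<^sup>*" using less.IH[of k p] p Suc by simp
        then show ?thesis using p True less.prems
          by (meson IntI SigmaI converse_rtrancl_into_rtrancl)
      next
        case False
        then have "W \<subseteq> hs p u" using W p less.prems unfolding conv_def by blast
        then obtain m where "m < k" "(u, v) \<in> E ^^ m"
          using hs_reenter[OF edge_sym[OF p(1)] p(2)] notin_hs[OF edge_sym[OF p(1)]] assms(3)
          by blast
        then show ?thesis using less.IH[of m u] less.prems Suc by simp
      qed
    qed
  qed
  moreover have "(u, v) \<in> E\<^sup>*" using connected assms unfolding conv_def by blast
  ultimately show ?thesis using assms by (meson rtrancl_imp_relpow)
qed

lemma conv_crossing:
  assumes e: "(x, y) \<in> E" and W: "conv W"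
    and u: "u \<in> W" "u \<in> hs x y" and v: "v \<in> W" "v \<in> hs y x"
  shows "x \<in> W \<and> y \<in> W"
proof -
  have "v \<in> hs x y \<or> x \<in> W \<and> y \<in> W" using conv_connected[OF W u(1) v(1)]
  proof (induction rule: rtrancl_induct)
    case base
    then show ?case using u by blast
  next
    case (step a b)
    then show ?case using hs_exit[OF e] by blast
  qed
  then show ?thesis using v hs_disjoint[OF e] by blast
qed

lemma conv_on_one_side:
  assumes "(x, y) \<in> E" "conv W" "x \<notin> W \<or> y \<notin> W"
  shows "W \<subseteq> hs x y \<or> W \<subseteq> hs y x"
  using conv_crossing[OF assms(1,2)] assms hs_cover[OF assms(1)] unfolding conv_def by blast

lemma is_subtree_conv:
  assumes "conv W" "W \<noteq> {}"
  shows "is_subtree W (E \<inter> W \<times> W) V E"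
proof -
  have "is_graph W (E \<inter> W \<times> W)"
    using tree unfolding is_tree_def is_graph_def irrefl_def sym_def by blast
  moreover have "is_cycle E xs" if "is_cycle (E \<inter> W \<times> W) xs" for xs
    using that unfolding is_cycle_def by blast
  ultimately show ?thesis
    using assms tree conv_connected unfolding is_subtree_def is_tree_def conv_def by blast
qed

text \<open>Take the edge by which a path from \<open>W\<close> to \<open>z\<close> leaves
  \<open>W\<close> for the last time; its foot \<open>u\<close> is the projection of
  \<open>z\<close> to \<open>W\<close>.\<close>

lemma conv_exit:
  assumes "conv W" "W \<noteq> {}" "z \<in> V" "z \<notin> W"
  obtains u p where "u \<in> W" "p \<notin> W" "(u, p) \<in> E" "z \<in> hs u p"
proof -
  obtain u0 where u0: "u0 \<in> W" using assms by blast
  then have "(u0, z) \<in> E\<^sup>*" using connected assms unfolding conv_def by blast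
  then have "z \<in> W \<or> (\<exists>u p. u \<in> W \<and> p \<notin> W \<and> (u, p) \<in> E \<and> z \<in> hs u p)"
  proof (induction rule: rtrancl_induct)
    case base
    then show ?case using u0 by blast
  next
    case (step a b)
    then show ?case using in_hs hs_exit by metis
  qed
  then show thesis using that assms by blast
qed

section \<open>Automorphisms and dense actions\<close>

abbreviation A :: "('v \<Rightarrow> 'v) monoid" where "A \<equiv> Aut_tree V E"

interpretation A: group A by (rule group_Aut_tree)

lemma carrier_A: "carrier A = tree_auts V E"
  by (simp add: Aut_tree_def)

lemma aut_bij: "g \<in> carrier A \<Longrightarrow> bij_betw g V V"
  by (simp add: carrier_A tree_auts_def Bij_def)

lemma aut_inj: "g \<in> carrier A \<Longrightarrow> inj_on g V"
  by (rule bij_betw_imp_inj_on[OF aut_bij])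

lemma aut_image: "g \<in> carrier A \<Longrightarrow> g ` V = V"
  by (rule bij_betw_imp_surj_on[OF aut_bij])

lemma aut_in: "g \<in> carrier A \<Longrightarrow> v \<in> V \<Longrightarrow> g v \<in> V"
  by (blast dest: aut_bij[THEN bij_betwE])

lemma aut_surj:
  assumes "g \<in> carrier A" "w \<in> V"
  obtains v where "v \<in> V" "w = g v"
  using aut_image[OF assms(1)] assms(2) by (metis imageE)

lemma aut_eq_iff: "g \<in> carrier A \<Longrightarrow> v \<in> V \<Longrightarrow> w \<in> V \<Longrightarrow> g v = g w \<longleftrightarrow> v = w"
  using aut_inj by (metis inj_onD)

lemma aut_edge_iff: "g \<in> carrier A \<Longrightarrow> v \<in> V \<Longrightarrow> w \<in> V \<Longrightarrow> (g v, g w) \<in> E \<longleftrightarrow> (v, w) \<in> E"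
  by (simp add: carrier_A tree_auts_def)

lemma aut_edge: "g \<in> carrier A \<Longrightarrow> (v, w) \<in> E \<Longrightarrow> (g v, g w) \<in> E"
  using aut_edge_iff edge_V by blast

lemma aut_eqI: "g \<in> carrier A \<Longrightarrow> h \<in> carrier A \<Longrightarrow> (\<And>v. v \<in> V \<Longrightarrow> g v = h v) \<Longrightarrow> g = h"
  unfolding carrier_A tree_auts_def Bij_def by (blast intro: extensionalityI)

lemma one_apply: "v \<in> V \<Longrightarrow> \<one>\<^bsub>A\<^esub> v = v"
  by (simp add: Aut_tree_def BijGroup_def)

lemma mult_apply:
  "g \<in> carrier A \<Longrightarrow> h \<in> carrier A \<Longrightarrow> v \<in> V \<Longrightarrow> (g \<otimes>\<^bsub>A\<^esub> h) v = g (h v)"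
  by (simp add: carrier_A tree_auts_def Aut_tree_def BijGroup_def compose_def)

lemma apply_inv: "g \<in> carrier A \<Longrightarrow> v \<in> V \<Longrightarrow> g ((inv\<^bsub>A\<^esub> g) v) = v"
  by (metis A.inv_closed A.r_inv mult_apply one_apply)

lemma mult_image:
  "g \<in> carrier A \<Longrightarrow> h \<in> carrier A \<Longrightarrow> W \<subseteq> V \<Longrightarrow> (g \<otimes>\<^bsub>A\<^esub> h) ` W = g ` h ` W"
  unfolding image_image by (rule image_cong) (auto simp: mult_apply)

lemma one_image: "W \<subseteq> V \<Longrightarrow> \<one>\<^bsub>A\<^esub> ` W = W"
  using one_apply by (force simp: image_iff)

lemma inv_image: "g \<in> carrier A \<Longrightarrow> W \<subseteq> V \<Longrightarrow> (inv\<^bsub>A\<^esub> g) ` g ` W = W"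
  by (metis A.inv_closed A.l_inv mult_image one_image)

lemma image_inv: "g \<in> carrier A \<Longrightarrow> W \<subseteq> V \<Longrightarrow> g ` (inv\<^bsub>A\<^esub> g) ` W = W"
  by (metis A.inv_closed A.r_inv mult_image one_image)

lemma aut_image_subset: "g \<in> carrier A \<Longrightarrow> W \<subseteq> V \<Longrightarrow> g ` W \<subseteq> V"
  using aut_in by blast

lemma aut_mem_image: "g \<in> carrier A \<Longrightarrow> W \<subseteq> V \<Longrightarrow> v \<in> V \<Longrightarrow> g v \<in> g ` W \<longleftrightarrow> v \<in> W"
  using aut_eq_iff by blast

lemma aut_image_Int:
  "g \<in> carrier A \<Longrightarrow> W \<subseteq> V \<Longrightarrow> W' \<subseteq> V \<Longrightarrow> g ` (W \<inter> W') = g ` W \<inter> g ` W'"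
  by (rule inj_on_image_Int[OF aut_inj])

text \<open>One inclusion is an induction along paths; the other applies it to the reversed edge and
  takes complements.\<close>

lemma aut_hs:
  assumes g: "g \<in> carrier A" and e: "(x, y) \<in> E"
  shows "g ` hs x y = hs (g x) (g y)"
proof -
  have sub: "g ` hs a b \<subseteq> hs (g a) (g b)" if e: "(a, b) \<in> E" for a b
  proof
    fix z assume "z \<in> g ` hs a b"
    then obtain w where w: "z = g w" "w \<in> V" "(b, w) \<in> (E - {(a, b), (b, a)})\<^sup>*"
      by (auto simp: hs_def)
    from w(3) have "g w \<in> hs (g a) (g b)"
    proof (induction rule: rtrancl_induct)
      case base
      show ?case using in_hs aut_edge g e by blast
    next
      case (step u w)
      then have uw: "(u, w) \<in> E" "(u, w) \<noteq> (a, b)" "(u, w) \<noteq> (b, a)" by auto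
      then show ?case
        using hs_step[OF step.IH aut_edge[OF g uw(1)]] aut_eq_iff[OF g] edge_V e by (metis prod.inject)
    qed
    then show "z \<in> hs (g a) (g b)" using w by simp
  qed
  have "hs (g x) (g y) \<subseteq> g ` hs x y"
  proof
    fix z assume z: "z \<in> hs (g x) (g y)"
    then obtain w where w: "w \<in> V" "z = g w" using hs_subset aut_surj[OF g] by blast
    have "w \<notin> hs y x"
      using sub[OF edge_sym[OF e]] z w hs_disjoint[OF aut_edge[OF g e]] by blast
    then show "z \<in> g ` hs x y" using hs_cover[OF e w(1)] w by blast
  qed
  then show ?thesis using sub[OF e] by blast
qed

lemma aut_half_tree: "g \<in> carrier A \<Longrightarrow> Y \<in> half_trees V E \<Longrightarrow> g ` Y \<in> half_trees V E"
  using aut_hs aut_edge unfolding half_trees_eq by blast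

lemma conv_image:
  assumes g: "g \<in> carrier A" and W: "conv W"
  shows "conv (g ` W)"
  unfolding conv_def
proof (intro conjI allI impI)
  have WV: "W \<subseteq> V" using W by (simp add: conv_def)
  then show "g ` W \<subseteq> V" using aut_in g by blast
  fix u p assume up: "u \<in> g ` W" "p \<notin> g ` W" "(u, p) \<in> E"
  obtain u' where u': "u' \<in> W" "u = g u'" using up by blast
  obtain p' where p': "p' \<in> V" "p = g p'" using edge_V[OF up(3)] aut_surj[OF g] by blast
  have "(u', p') \<in> E" using aut_edge_iff[OF g] u' p' up WV by blast
  moreover have "p' \<notin> W" using up p' by blast
  ultimately have "W \<subseteq> hs p' u'" using W u' unfolding conv_def by blast
  then show "g ` W \<subseteq> hs p u"
    using aut_hs[OF g edge_sym[OF \<open>(u', p') \<in> E\<close>]] u' p' by blast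
qed

section \<open>Combinatorial density and the translations it provides\<close>

definition no_invariant_conv :: "('v \<Rightarrow> 'v) set \<Rightarrow> bool" where
  "no_invariant_conv H \<longleftrightarrow>
     (\<forall>W. conv W \<longrightarrow> W \<noteq> {} \<longrightarrow> (\<forall>h \<in> H. h ` W \<subseteq> W) \<longrightarrow> W = V)"

text \<open>
  An orientation points every edge towards a common vertex or end, so excluding invariant ones
  is the combinatorial form of fixing no end (and no vertex).
\<close>

definition orientation :: "'v set set \<Rightarrow> bool" where
  "orientation U \<longleftrightarrow> U \<subseteq> half_trees V E \<and> (\<forall>x y. (x, y) \<in> E \<longrightarrow> hs x y \<in> U \<or> hs y x \<in> U) \<and>
     (\<forall>Y \<in> U. \<forall>Z \<in> U. Y \<inter> Z \<noteq> {})"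

definition no_invariant_orientation :: "('v \<Rightarrow> 'v) set \<Rightarrow> bool" where
  "no_invariant_orientation H \<longleftrightarrow> \<not> (\<exists>U. orientation U \<and> (\<forall>h \<in> H. \<forall>Y \<in> U. h ` Y \<in> U))"

definition dense_action :: "('v \<Rightarrow> 'v) set \<Rightarrow> bool" where
  "dense_action H \<longleftrightarrow> no_invariant_conv H \<and> no_invariant_orientation H"

lemma no_invariant_convD:
  "no_invariant_conv H \<Longrightarrow> conv W \<Longrightarrow> W \<noteq> {} \<Longrightarrow> (\<And>h. h \<in> H \<Longrightarrow> h ` W \<subseteq> W) \<Longrightarrow> W = V"
  unfolding no_invariant_conv_def by blast

text \<open>The invariant core of an orbit; that it is nonempty must be shown in each application.
  Invariance under \<open>k\<close> reindexes the orbit by the inverse of \<open>k\<close> times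
  \<open>h\<close>.\<close>

lemma conv_Inter_orbit:
  assumes H: "subgroup H A" and W: "conv W"
  shows "conv (V \<inter> (\<Inter>h \<in> H. h ` W))"
    and "\<And>k. k \<in> H \<Longrightarrow> k ` (V \<inter> (\<Inter>h \<in> H. h ` W)) \<subseteq> V \<inter> (\<Inter>h \<in> H. h ` W)"
proof -
  have HA: "h \<in> carrier A" if "h \<in> H" for h using subgroup.mem_carrier[OF H that] .
  have WV: "W \<subseteq> V" using W by (simp add: conv_def)
  show "conv (V \<inter> (\<Inter>h \<in> H. h ` W))" by (rule conv_Inter) (use conv_image W HA in blast)
  fix k assume k: "k \<in> H"
  show "k ` (V \<inter> (\<Inter>h \<in> H. h ` W)) \<subseteq> V \<inter> (\<Inter>h \<in> H. h ` W)"
  proof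
    fix z assume "z \<in> k ` (V \<inter> (\<Inter>h \<in> H. h ` W))"
    then obtain w where w: "z = k w" "w \<in> V" "\<And>h. h \<in> H \<Longrightarrow> w \<in> h ` W" by blast
    have "z \<in> h ` W" if h: "h \<in> H" for h
    proof -
      let ?m = "inv\<^bsub>A\<^esub> k \<otimes>\<^bsub>A\<^esub> h"
      have m: "?m \<in> H" using k h H by (simp add: subgroup.m_closed subgroup.m_inv_closed)
      have "z \<in> k ` ?m ` W" using w(1) w(3)[OF m] by blast
      also have "k ` ?m ` W = (k \<otimes>\<^bsub>A\<^esub> ?m) ` W"
        using mult_image[OF HA[OF k] HA[OF m] WV] by simp
      also have "k \<otimes>\<^bsub>A\<^esub> ?m = h"
        using HA[OF k] HA[OF h] A.m_assoc[symmetric] by simp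
      finally show ?thesis .
    qed
    then show "z \<in> V \<inter> (\<Inter>h \<in> H. h ` W)" using w aut_in HA k by blast
  qed
qed

text \<open>If every translate met \<open>W\<close>, any two translates would meet, and the
  half-trees containing some translate of \<open>W\<close> would form an invariant
  orientation.\<close>

lemma disjoint_translate:
  assumes H: "subgroup H A" and d: "dense_action H"
    and W: "conv W" "W \<noteq> {}" "W \<noteq> V"
  shows "\<exists>h \<in> H. h ` W \<inter> W = {}"
proof (rule ccontr)
  assume "\<not> (\<exists>h \<in> H. h ` W \<inter> W = {})"
  then have meet: "h ` W \<inter> W \<noteq> {}" if "h \<in> H" for h using that by simp
  have HA: "h \<in> carrier A" if "h \<in> H" for h using subgroup.mem_carrier[OF H that] .
  have WV: "W \<subseteq> V" using W by (simp add: conv_def)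
  define U where "U = {Y \<in> half_trees V E. \<exists>h \<in> H. h ` W \<subseteq> Y}"
  have "orientation U"
    unfolding orientation_def
  proof (intro conjI allI impI ballI)
    show "U \<subseteq> half_trees V E" unfolding U_def by blast
  next
    fix x y assume e: "(x, y) \<in> E"
    show "hs x y \<in> U \<or> hs y x \<in> U"
    proof (rule ccontr)
      assume "\<not> (hs x y \<in> U \<or> hs y x \<in> U)"
      then have "\<not> h ` W \<subseteq> hs x y \<and> \<not> h ` W \<subseteq> hs y x" if "h \<in> H" for h
        using that e edge_sym half_tree_hs unfolding U_def by blast
      \<comment> \<open>An edge with neither side in \<open>U\<close> has both sides met by every
        translate, so every translate contains its endpoints and the core of the orbit is
        nonempty.\<close>
      then have x: "x \<in> h ` W" if "h \<in> H" for h
        using that conv_on_one_side[OF e conv_image[OF HA W(1)]] by blast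
      have "V \<inter> (\<Inter>h \<in> H. h ` W) = V"
        by (rule no_invariant_convD[of H])
          (use d conv_Inter_orbit[OF H W(1)] x edge_V[OF e] in \<open>auto simp: dense_action_def\<close>)
      then have "V \<subseteq> \<one>\<^bsub>A\<^esub> ` W" using H subgroup.one_closed by blast
      then show False using one_image[OF WV] W WV by blast
    qed
  next
    fix Y Z assume "Y \<in> U" "Z \<in> U"
    then obtain h k where hk: "h \<in> H" "k \<in> H" "h ` W \<subseteq> Y" "k ` W \<subseteq> Z" unfolding U_def by blast
    let ?m = "inv\<^bsub>A\<^esub> h \<otimes>\<^bsub>A\<^esub> k"
    have m: "?m \<in> H" using hk H by (simp add: subgroup.m_closed subgroup.m_inv_closed)
    have "h \<otimes>\<^bsub>A\<^esub> ?m = k" using HA[OF hk(1)] HA[OF hk(2)] A.m_assoc[symmetric] by simp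
    then have "h ` ?m ` W = k ` W" using mult_image[OF HA[OF hk(1)] HA[OF m] WV] by simp
    then have "h ` (?m ` W \<inter> W) \<subseteq> Y \<inter> Z" using hk by blast
    then show "Y \<inter> Z \<noteq> {}" using meet[OF m] by blast
  qed
  moreover have "k ` Y \<in> U" if k: "k \<in> H" and Y: "Y \<in> U" for k Y
  proof -
    obtain h where h: "h \<in> H" "h ` W \<subseteq> Y" using Y unfolding U_def by blast
    have "k \<otimes>\<^bsub>A\<^esub> h \<in> H" using H h k subgroup.m_closed by metis
    moreover have "(k \<otimes>\<^bsub>A\<^esub> h) ` W \<subseteq> k ` Y"
      using mult_image[OF HA[OF k] HA[OF h(1)] WV] h by auto
    ultimately show ?thesis using Y aut_half_tree[OF HA[OF k]] unfolding U_def by blast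
  qed
  ultimately show False using d unfolding dense_action_def no_invariant_orientation_def by blast
qed

text \<open>The vertex \<open>p\<close> just outside \<open>C\<close> lies on one side of the edge.
  The other side misses \<open>p\<close>, so it lies inside or outside \<open>C\<close> as a whole;
  it contains \<open>a\<close>, or else \<open>b\<close>, and \<open>b\<close> is outside
  \<open>C\<close> only if it is \<open>p\<close> itself.\<close>

lemma half_tree_side:
  assumes e: "(a, b) \<in> E" and C: "C \<in> half_trees V E" and a: "a \<in> C"
  shows "hs a b \<subseteq> C \<or> hs b a \<subseteq> C"
proof -
  obtain p q where pq: "(p, q) \<in> E" "C = hs p q" using C by (rule half_treeE)
  consider "p \<in> hs b a" | "p \<in> hs a b" using hs_cover[OF e] edge_V[OF pq(1)] by blast
  then show ?thesis
  proof cases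
    case 1
    then have p: "p \<notin> hs a b" using hs_disjoint[OF e] by blast
    have "\<not> hs a b \<subseteq> hs q p"
    proof
      assume "hs a b \<subseteq> hs q p"
      then have b: "b \<in> hs q p" using in_hs[OF e] by blast
      then have "b \<notin> C" using hs_disjoint pq by blast
      then have "b = p" using hs_exit[OF pq(1), of a b] a e pq by blast
      then show False using p in_hs[OF e] by blast
    qed
    then show ?thesis
      using conv_on_one_side[OF pq(1) conv_half_tree[OF half_tree_hs[OF e]]] p pq by blast
  next
    case 2
    then have p: "p \<notin> hs b a" using hs_disjoint[OF e] by blast
    have "\<not> hs b a \<subseteq> hs q p"
      using in_hs[OF edge_sym[OF e]] a hs_disjoint[OF pq(1)] pq by blast
    then show ?thesis
      using conv_on_one_side[OF pq(1) conv_half_tree[OF half_tree_hs[OF edge_sym[OF e]]]] p pq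
      by blast
  qed
qed

text \<open>Some translate of \<open>x\<close> enters \<open>C\<close>, since otherwise every
  translate of the complement of \<open>C\<close> would contain \<open>x\<close> and their
  intersection would be a proper invariant convex set. One side of the translated edge then lies in
  \<open>C\<close>; if it is the wrong side, \<open>Y\<close> is first moved off itself into
  \<open>hs y x\<close>.\<close>

lemma translate_into:
  assumes H: "subgroup H A" and d: "dense_action H"
    and Y: "Y \<in> half_trees V E" and C: "C \<in> half_trees V E"
  obtains h where "h \<in> H" "h ` Y \<subseteq> C"
proof -
  have HA: "h \<in> carrier A" if "h \<in> H" for h using subgroup.mem_carrier[OF H that] .
  obtain x y where xy: "(x, y) \<in> E" "Y = hs x y" using Y by (rule half_treeE)
  have x: "x \<in> V" using edge_V xy by blast
  have CV: "C \<subseteq> V" using C half_tree_subset by blast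
  have "\<exists>h \<in> H. h x \<in> C"
  proof (rule ccontr)
    assume no: "\<not> (\<exists>h \<in> H. h x \<in> C)"
    let ?W = "V - C"
    have W: "conv ?W" using conv_half_tree half_tree_compl C by blast
    have "x \<in> h ` ?W" if h: "h \<in> H" for h
    proof -
      have "(inv\<^bsub>A\<^esub> h) x \<in> ?W"
        using no subgroup.m_inv_closed[OF H h] aut_in HA x by blast
      then show ?thesis using apply_inv[OF HA[OF h] x] by (metis image_eqI)
    qed
    then have "V \<inter> (\<Inter>h \<in> H. h ` ?W) = V"
      by (intro no_invariant_convD[of H])
        (use d conv_Inter_orbit[OF H W] x in \<open>auto simp: dense_action_def\<close>)
    then have "V \<subseteq> \<one>\<^bsub>A\<^esub> ` ?W" using H subgroup.one_closed by blast
    then have "V \<subseteq> V - C" using one_image[of ?W] by auto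
    then show False using half_tree_nonempty[OF C] CV by blast
  qed
  then obtain h where h: "h \<in> H" "h x \<in> C" by blast
  have "h ` Y \<subseteq> C \<or> h ` hs y x \<subseteq> C"
    using half_tree_side[OF aut_edge[OF HA[OF h(1)] xy(1)] C h(2)] aut_hs[OF HA[OF h(1)]]
      xy edge_sym by simp
  then show thesis
  proof
    assume "h ` Y \<subseteq> C"
    then show thesis using that h by blast
  next
    assume hc: "h ` hs y x \<subseteq> C"
    obtain k where k: "k \<in> H" "k ` Y \<inter> Y = {}"
      using disjoint_translate[OF H d conv_half_tree[OF Y] half_tree_nonempty[OF Y]
          half_tree_proper[OF Y]] by blast
    have YV: "Y \<subseteq> V" using Y half_tree_subset by blast
    have "k ` Y \<subseteq> hs y x"
      using k aut_image_subset[OF HA[OF k(1)] YV] hs_cover[OF xy(1)] xy by blast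
    then have "(h \<otimes>\<^bsub>A\<^esub> k) ` Y \<subseteq> C"
      using mult_image[OF HA[OF h(1)] HA[OF k(1)] YV] hc by auto
    then show thesis using that subgroup.m_closed[OF H h(1) k(1)] by blast
  qed
qed

section \<open>Normal subgroups of dense actions\<close>

text \<open>This rules out the line, where density is not inherited: its full automorphism group is
  dense, but the normal subgroup of translations fixes both ends.\<close>

definition branching :: bool where
  "branching \<longleftrightarrow> (\<exists>v w1 w2 w3. (v, w1) \<in> E \<and> (v, w2) \<in> E \<and> (v, w3) \<in> E \<and> distinct [w1, w2, w3])"

text \<open>On an \<open>h\<close>-translate, \<open>n\<close> acts through a conjugate of
  \<open>n\<close>, which normality keeps in \<open>N\<close>.\<close>

lemma conj_image:
  assumes "h \<in> carrier A" "n \<in> carrier A" "W \<subseteq> V"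
  shows "n ` h ` W = h ` (inv\<^bsub>A\<^esub> h \<otimes>\<^bsub>A\<^esub> n \<otimes>\<^bsub>A\<^esub> h) ` W"
proof -
  have "h \<otimes>\<^bsub>A\<^esub> (inv\<^bsub>A\<^esub> h \<otimes>\<^bsub>A\<^esub> n \<otimes>\<^bsub>A\<^esub> h) = n \<otimes>\<^bsub>A\<^esub> h"
    using assms by (simp add: A.m_assoc[symmetric])
  then show ?thesis using assms by (simp add: mult_image[symmetric])
qed

lemma conj_apply:
  assumes "h \<in> carrier A" "n \<in> carrier A" "v \<in> V"
  shows "n (h v) = h ((inv\<^bsub>A\<^esub> h \<otimes>\<^bsub>A\<^esub> n \<otimes>\<^bsub>A\<^esub> h) v)"
proof -
  have "h \<otimes>\<^bsub>A\<^esub> (inv\<^bsub>A\<^esub> h \<otimes>\<^bsub>A\<^esub> n \<otimes>\<^bsub>A\<^esub> h) = n \<otimes>\<^bsub>A\<^esub> h"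
    using assms by (simp add: A.m_assoc[symmetric])
  then show ?thesis using assms by (simp add: mult_apply[symmetric])
qed

lemma conj_inv_mem:
  assumes "subgroup H A" "\<And>h n. h \<in> H \<Longrightarrow> n \<in> N \<Longrightarrow> h \<otimes>\<^bsub>A\<^esub> n \<otimes>\<^bsub>A\<^esub> inv\<^bsub>A\<^esub> h \<in> N"
    "h \<in> H" "n \<in> N"
  shows "inv\<^bsub>A\<^esub> h \<otimes>\<^bsub>A\<^esub> n \<otimes>\<^bsub>A\<^esub> h \<in> N"
  using assms(2)[OF subgroup.m_inv_closed[OF assms(1,3)] assms(4)]
    A.inv_inv[OF subgroup.mem_carrier[OF assms(1,3)]] by simp

text \<open>The inclusions for \<open>h\<close> and for its inverse combine; hence
  \<open>no_invariant_conv\<close> asks only for inclusion.\<close>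

lemma invariant_image_eq:
  assumes H: "subgroup H A" and W: "W \<subseteq> V" and inv: "\<And>h. h \<in> H \<Longrightarrow> h ` W \<subseteq> W" and h: "h \<in> H"
  shows "h ` W = W"
proof
  have "h ` (inv\<^bsub>A\<^esub> h) ` W \<subseteq> h ` W"
    by (rule image_mono) (rule inv[OF subgroup.m_inv_closed[OF H h]])
  then show "W \<subseteq> h ` W" using image_inv[OF subgroup.mem_carrier[OF H h] W] by simp
qed (rule inv[OF h])

text \<open>If \<open>n\<close> fixes \<open>u\<close> and moves its neighbour \<open>p\<close>, it
  carries the branch at \<open>u\<close> through \<open>p\<close> to a disjoint branch, so no fixed
  vertex lies beyond \<open>p\<close>.\<close>

lemma conv_fixed_points:
  assumes "N \<subseteq> carrier A"
  shows "conv {v \<in> V. \<forall>n \<in> N. n v = v}" (is "conv ?F")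
  unfolding conv_def
proof (intro conjI allI impI)
  show "?F \<subseteq> V" by blast
  fix u p assume up: "u \<in> ?F" "p \<notin> ?F" "(u, p) \<in> E"
  obtain n where n: "n \<in> N" "n p \<noteq> p" using up edge_V[OF up(3)] by blast
  have nA: "n \<in> carrier A" using n assms by blast
  have nu: "n u = u" using up n by blast
  have e: "(u, n p) \<in> E" using aut_edge[OF nA up(3)] nu by simp
  show "?F \<subseteq> hs p u"
  proof
    fix v assume v: "v \<in> ?F"
    have "v \<notin> hs u p"
    proof
      assume vu: "v \<in> hs u p"
      have "n v \<in> n ` hs u p" using vu by (rule imageI)
      moreover have "n v = v" using v n by blast
      ultimately have "v \<in> hs u (n p)" using aut_hs[OF nA up(3)] nu by simp
      then show False using hs_neighbour_disjoint[OF e up(3) n(2)] vu by blast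
    qed
    then show "v \<in> hs p u" using hs_cover[OF up(3), of v] v by blast
  qed
qed

text \<open>
  If \<open>W\<close> is a proper \<open>N\<close>-invariant convex set, then so is some translate disjoint from \<open>W\<close>, and \<open>N\<close>
  fixes the foot in \<open>W\<close> of the bridge between the two; so the set of \<open>N\<close>-fixed vertices is
  nonempty, and it is \<open>H\<close>-invariant.
\<close>

lemma normal_no_invariant_conv:
  assumes H: "subgroup H A" and d: "dense_action H" and N: "subgroup N A"
    and norm: "\<And>h n. h \<in> H \<Longrightarrow> n \<in> N \<Longrightarrow> h \<otimes>\<^bsub>A\<^esub> n \<otimes>\<^bsub>A\<^esub> inv\<^bsub>A\<^esub> h \<in> N"
    and nontriv: "N \<noteq> {\<one>\<^bsub>A\<^esub>}"
  shows "no_invariant_conv N"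
  unfolding no_invariant_conv_def
proof (intro allI impI)
  fix W assume W: "conv W" "W \<noteq> {}" and "\<forall>n \<in> N. n ` W \<subseteq> W"
  then have invW: "n ` W \<subseteq> W" if "n \<in> N" for n using that by simp
  have HA: "h \<in> carrier A" if "h \<in> H" for h using subgroup.mem_carrier[OF H that] .
  have NA: "n \<in> carrier A" if "n \<in> N" for n using subgroup.mem_carrier[OF N that] .
  have WV: "W \<subseteq> V" using W by (simp add: conv_def)
  show "W = V"
  proof (rule ccontr)
    assume "W \<noteq> V"
    then obtain h where h: "h \<in> H" "h ` W \<inter> W = {}"
      using disjoint_translate[OF H d W] by auto
    define W' where "W' = h ` W"
    have W': "conv W'" unfolding W'_def by (rule conv_image[OF HA[OF h(1)] W(1)])
    have W'V: "W' \<subseteq> V" using W' by (simp add: conv_def)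
    have invW': "n ` W' \<subseteq> W'" if n: "n \<in> N" for n
      unfolding W'_def conj_image[OF HA[OF h(1)] NA[OF n] WV]
      by (rule image_mono) (rule invW[OF conj_inv_mem[OF H norm h(1) n]])
    obtain z where z: "z \<in> W'" using W unfolding W'_def by blast
    have "z \<notin> W" using z h W'_def by blast
    then obtain u p where up: "u \<in> W" "p \<notin> W" "(u, p) \<in> E" "z \<in> hs u p"
      using conv_exit[OF W, of z] W'V z by blast
    have "u \<notin> W'" using up h W'_def by blast
    then have W'P: "W' \<subseteq> hs u p"
      using conv_on_one_side[OF up(3) W'] up z hs_disjoint[OF up(3)] by blast
    \<comment> \<open>The edge from \<open>u\<close> to \<open>p\<close> and its image under
      \<open>n\<close> both lead from \<open>W\<close> towards \<open>W'\<close>. The half-tree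
      beyond the image contains \<open>p\<close> but not \<open>u\<close>, so the two edges
      coincide.\<close>
    have fix_u: "n u = u" if n: "n \<in> N" for n
    proof -
      have e: "(n u, n p) \<in> E" by (rule aut_edge[OF NA[OF n] up(3)])
      have nu: "n u \<in> W" using invW[OF n] up by blast
      have np: "n p \<notin> W"
        using aut_mem_image[OF NA[OF n] WV, of p] edge_V[OF up(3)] up
          invariant_image_eq[OF N WV invW n] by simp
      have Q: "n ` hs u p = hs (n u) (n p)" by (rule aut_hs[OF NA[OF n] up(3)])
      have nzP: "n z \<in> hs u p" using invW'[OF n] W'P z by blast
      have nzQ: "n z \<in> hs (n u) (n p)" using up(4) Q by blast
      have WP: "W \<subseteq> hs p u" using W(1) up unfolding conv_def by blast
      have WQ: "W \<subseteq> hs (n p) (n u)" using W(1) nu np e unfolding conv_def by blast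
      have "n u \<notin> hs u p" using WP nu hs_disjoint[OF up(3)] by blast
      then have PQ: "hs u p \<subseteq> hs (n u) (n p)"
        using conv_on_one_side[OF e conv_half_tree[OF half_tree_hs[OF up(3)]]]
          nzP nzQ hs_disjoint[OF e] by blast
      have "u \<notin> hs (n u) (n p)" using WQ up hs_disjoint[OF e] by blast
      moreover have "p \<in> hs (n u) (n p)" using PQ in_hs[OF up(3)] by blast
      ultimately show ?thesis using hs_exit[OF e _ edge_sym[OF up(3)]] by simp
    qed
    let ?F = "{v \<in> V. \<forall>n \<in> N. n v = v}"
    have "?F = V"
    proof (rule no_invariant_convD[of H])
      show "no_invariant_conv H" using d by (simp add: dense_action_def)
      show "conv ?F" by (rule conv_fixed_points) (use NA in blast)
      show "?F \<noteq> {}" using fix_u edge_V[OF up(3)] by blast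
      fix k assume k: "k \<in> H"
      show "k ` ?F \<subseteq> ?F"
      proof
        fix y assume "y \<in> k ` ?F"
        then obtain v where v: "y = k v" "v \<in> V" "\<And>n. n \<in> N \<Longrightarrow> n v = v" by blast
        have "n y = y" if n: "n \<in> N" for n
          using conj_apply[OF HA[OF k] NA[OF n] v(2)] v(1) v(3)[OF conj_inv_mem[OF H norm k n]]
          by simp
        then show "y \<in> ?F" using v aut_in[OF HA[OF k]] by simp
      qed
    qed
    then have fixed: "n v = v" if "n \<in> N" "v \<in> V" for n v using that by blast
    have "n = \<one>\<^bsub>A\<^esub>" if "n \<in> N" for n
      by (rule aut_eqI) (use that fixed NA one_apply in auto)
    then show False using nontriv subgroup.one_closed[OF N] by blast
  qed
qed

text \<open>
  Two distinct \<open>N\<close>-fixed ends span an \<open>N\<close>-invariant line, which would be the whole tree.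
\<close>

lemma normal_no_invariant_orientation:
  assumes H: "subgroup H A" and d: "dense_action H" and N: "subgroup N A"
    and norm: "\<And>h n. h \<in> H \<Longrightarrow> n \<in> N \<Longrightarrow> h \<otimes>\<^bsub>A\<^esub> n \<otimes>\<^bsub>A\<^esub> inv\<^bsub>A\<^esub> h \<in> N"
    and nc: "no_invariant_conv N" and br: branching
  shows "no_invariant_orientation N"
  unfolding no_invariant_orientation_def
proof
  assume "\<exists>U. orientation U \<and> (\<forall>n \<in> N. \<forall>Y \<in> U. n ` Y \<in> U)"
  then obtain U where U: "orientation U" and invU: "\<And>n Y. n \<in> N \<Longrightarrow> Y \<in> U \<Longrightarrow> n ` Y \<in> U"
    by auto
  have HA: "h \<in> carrier A" if "h \<in> H" for h using subgroup.mem_carrier[OF H that] .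
  have NA: "n \<in> carrier A" if "n \<in> N" for n using subgroup.mem_carrier[OF N that] .
  have U1: "Y \<in> half_trees V E" if "Y \<in> U" for Y using U that unfolding orientation_def by blast
  have U2: "hs x y \<in> U \<or> hs y x \<in> U" if "(x, y) \<in> E" for x y
    using U that unfolding orientation_def by blast
  have U3: "Y \<inter> Z \<noteq> {}" if "Y \<in> U" "Z \<in> U" for Y Z using U that unfolding orientation_def by blast
  have "\<not> (\<forall>h \<in> H. \<forall>Y \<in> U. h ` Y \<in> U)"
    using d U unfolding dense_action_def no_invariant_orientation_def by blast
  then obtain h Y where h: "h \<in> H" and Y: "Y \<in> U" "h ` Y \<notin> U" by blast
  \<comment> \<open>Normality makes this translate \<open>N\<close>-invariant as well; it plays the
    role of the second end.\<close>
  define U' where "U' = (\<lambda>Y. h ` Y) ` U"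
  have U'1: "Z \<in> half_trees V E" if "Z \<in> U'" for Z
    using that aut_half_tree[OF HA[OF h]] U1 unfolding U'_def by blast
  have U'2: "hs x y \<in> U' \<or> hs y x \<in> U'" if e: "(x, y) \<in> E" for x y
  proof -
    obtain x' where x: "x' \<in> V" "x = h x'" using aut_surj[OF HA[OF h]] edge_V[OF e] by blast
    obtain y' where y: "y' \<in> V" "y = h y'" using aut_surj[OF HA[OF h]] edge_V[OF e] by blast
    have e': "(x', y') \<in> E" using aut_edge_iff[OF HA[OF h] x(1) y(1)] e x y by simp
    have "hs x y = h ` hs x' y'" "hs y x = h ` hs y' x'"
      using aut_hs[OF HA[OF h] e'] aut_hs[OF HA[OF h] edge_sym[OF e']] x y by simp_all
    then show ?thesis using U2[OF e'] unfolding U'_def by blast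
  qed
  have U'3: "Z \<inter> Z' \<noteq> {}" if "Z \<in> U'" "Z' \<in> U'" for Z Z'
  proof -
    obtain Y Y' where "Y \<in> U" "Y' \<in> U" "Z = h ` Y" "Z' = h ` Y'" using \<open>Z \<in> U'\<close> \<open>Z' \<in> U'\<close> unfolding U'_def by blast
    then show ?thesis using U3[of Y Y'] by blast
  qed
  have invU': "n ` Z \<in> U'" if n: "n \<in> N" and Z: "Z \<in> U'" for n Z
  proof -
    obtain Y where Y: "Y \<in> U" "Z = h ` Y" using Z unfolding U'_def by blast
    have "n ` Z = h ` (inv\<^bsub>A\<^esub> h \<otimes>\<^bsub>A\<^esub> n \<otimes>\<^bsub>A\<^esub> h) ` Y"
      unfolding Y(2) by (rule conj_image[OF HA[OF h] NA[OF n] half_tree_subset[OF U1[OF Y(1)]]])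
    then show ?thesis
      unfolding U'_def using invU[OF conj_inv_mem[OF H norm h n] Y(1)] by blast
  qed
  obtain x y where xy: "(x, y) \<in> E" "h ` Y = hs x y"
    using aut_half_tree[OF HA[OF h] U1[OF Y(1)]] by (rule half_treeE)
  have yx: "hs y x \<in> U" using U2[OF xy(1)] xy Y by auto
  have xy': "hs x y \<in> U'" using xy Y unfolding U'_def by blast
  have xV: "x \<in> V" using edge_V[OF xy(1)] by blast
  \<comment> \<open>\<open>U\<close> and \<open>U'\<close> orient the edge between \<open>x\<close>
    and \<open>y\<close> oppositely, so it lies on the line joining the two ends. A half-tree in
    both families meets both sides of the edge and hence contains its endpoints.\<close>
  have xZ: "x \<in> Z" if Z: "Z \<in> U" "Z \<in> U'" for Z
    using conv_on_one_side[OF xy(1) conv_half_tree[OF U1[OF Z(1)]]]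
      U3[OF Z(1) yx] U'3[OF Z(2) xy'] hs_disjoint[OF xy(1)] by blast
  \<comment> \<open>The intersection is the line between the two ends. Once it is all of
    \<open>V\<close>, no half-tree can lie in both families.\<close>
  have L: "V \<inter> \<Inter>(U \<inter> U') = V"
  proof (rule no_invariant_convD[OF nc])
    show "conv (V \<inter> \<Inter>(U \<inter> U'))" by (rule conv_Inter) (use conv_half_tree U1 in blast)
    show "V \<inter> \<Inter>(U \<inter> U') \<noteq> {}" using xZ xV by blast
    fix n assume n: "n \<in> N"
    show "n ` (V \<inter> \<Inter>(U \<inter> U')) \<subseteq> V \<inter> \<Inter>(U \<inter> U')"
    proof
      fix z assume "z \<in> n ` (V \<inter> \<Inter>(U \<inter> U'))"
      then obtain v where v: "z = n v" "v \<in> V" "\<And>Z. Z \<in> U \<Longrightarrow> Z \<in> U' \<Longrightarrow> v \<in> Z" by blast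
      have "z \<in> Z" if Z: "Z \<in> U" "Z \<in> U'" for Z
      proof -
        have m: "inv\<^bsub>A\<^esub> n \<in> N" by (rule subgroup.m_inv_closed[OF N n])
        have "v \<in> (inv\<^bsub>A\<^esub> n) ` Z" by (rule v(3)[OF invU[OF m Z(1)] invU'[OF m Z(2)]])
        then have "z \<in> n ` (inv\<^bsub>A\<^esub> n) ` Z" using v by blast
        then show ?thesis using image_inv[OF NA[OF n] half_tree_subset[OF U1[OF Z(1)]]] by simp
      qed
      then show "z \<in> V \<inter> \<Inter>(U \<inter> U')" using v aut_in[OF NA[OF n]] by simp
    qed
  qed
  have disj: "Z \<notin> U'" if "Z \<in> U" for Z
    using L half_tree_proper[OF U1[OF that]] half_tree_subset[OF U1[OF that]] that by blast
  obtain v w1 w2 w3 where w: "(v, w1) \<in> E" "(v, w2) \<in> E" "(v, w3) \<in> E"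
    "w1 \<noteq> w2" "w1 \<noteq> w3" "w2 \<noteq> w3" using br unfolding branching_def by auto
  \<comment> \<open>Of the three branches at \<open>v\<close>, two fall into the same family,
    although they are disjoint.\<close>
  have either: "hs v w \<in> U \<or> hs v w \<in> U'" if "(v, w) \<in> E" for w
    using U2[OF that] U'2[OF that] disj by blast
  show False
    using either[OF w(1)] either[OF w(2)] either[OF w(3)]
      hs_neighbour_disjoint[OF w(1) w(2) w(4)] hs_neighbour_disjoint[OF w(1) w(3) w(5)]
      hs_neighbour_disjoint[OF w(2) w(3) w(6)] U3 U'3 by metis
qed

lemma normal_dense_action:
  assumes "subgroup H A" "dense_action H" "subgroup N A"
    and "\<And>h n. h \<in> H \<Longrightarrow> n \<in> N \<Longrightarrow> h \<otimes>\<^bsub>A\<^esub> n \<otimes>\<^bsub>A\<^esub> inv\<^bsub>A\<^esub> h \<in> N"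
    and "N \<noteq> {\<one>\<^bsub>A\<^esub>}" branching
  shows "dense_action N"
  using normal_no_invariant_conv[OF assms(1-5)]
    normal_no_invariant_orientation[OF assms(1-4) _ assms(6)]
  unfolding dense_action_def by blast

section \<open>Geometric density\<close>

lemma geometrically_dense_no_invariant_conv:
  assumes G: "subgroup G A" and gd: "geometrically_dense V E G"
  shows "no_invariant_conv G"
  unfolding no_invariant_conv_def
proof (intro allI impI)
  fix W assume W: "conv W" "W \<noteq> {}" and "\<forall>g \<in> G. g ` W \<subseteq> W"
  then have inv: "g ` W \<subseteq> W" if "g \<in> G" for g using that by simp
  have WV: "W \<subseteq> V" using W by (simp add: conv_def)
  have GA: "g \<in> carrier A" if "g \<in> G" for g using subgroup.mem_carrier[OF G that] .
  have eq: "g ` W = W" if "g \<in> G" for g by (rule invariant_image_eq[OF G WV inv that])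
  have "map_prod g g ` (E \<inter> W \<times> W) = E \<inter> W \<times> W" if g: "g \<in> G" for g
  proof
    show "map_prod g g ` (E \<inter> W \<times> W) \<subseteq> E \<inter> W \<times> W"
      using aut_edge[OF GA[OF g]] inv[OF g] by auto
    show "E \<inter> W \<times> W \<subseteq> map_prod g g ` (E \<inter> W \<times> W)"
    proof
      fix e assume e: "e \<in> E \<inter> W \<times> W"
      then obtain a b where ab: "e = (a, b)" "(a, b) \<in> E" "a \<in> g ` W" "b \<in> g ` W"
        unfolding eq[OF g] by blast
      then obtain a' b' where ab': "a' \<in> W" "b' \<in> W" "a = g a'" "b = g b'" by blast
      then have "(a', b') \<in> E \<inter> W \<times> W" using aut_edge_iff[OF GA[OF g]] ab WV by blast
      then show "e \<in> map_prod g g ` (E \<inter> W \<times> W)" using ab ab' by (metis image_eqI map_prod_simp)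
    qed
  qed
  then have "preserves_subtree G W (E \<inter> W \<times> W)" using eq by (simp add: preserves_subtree_def)
  then show "W = V" using gd is_subtree_conv[OF W] unfolding geometrically_dense_def by blast
qed

text \<open>Each vertex has exactly one neighbour \<open>f v\<close> in the direction chosen by
  \<open>U\<close>. The map \<open>f\<close> commutes with \<open>G\<close>, its iterates trace a
  ray, and any two of its forward orbits merge, so the end of that ray is fixed.\<close>

lemma invariant_orientation_fixes_end:
  assumes G: "subgroup G A" and nc: "no_invariant_conv G"
    and U: "orientation U" "U \<noteq> {}" and inv: "\<And>g Y. g \<in> G \<Longrightarrow> Y \<in> U \<Longrightarrow> g ` Y \<in> U"
  shows "\<exists>\<xi> \<in> tree_ends E. fixes_end G \<xi>"
proof -
  have GA: "g \<in> carrier A" if "g \<in> G" for g using subgroup.mem_carrier[OF G that] .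
  have U1: "Y \<in> half_trees V E" if "Y \<in> U" for Y using U that unfolding orientation_def by blast
  have U2: "hs x y \<in> U \<or> hs y x \<in> U" if "(x, y) \<in> E" for x y
    using U that unfolding orientation_def by blast
  have U3: "Y \<inter> Z \<noteq> {}" if "Y \<in> U" "Z \<in> U" for Y Z using U that unfolding orientation_def by blast
  have empty: "V \<inter> \<Inter>U = {}"
  proof (rule ccontr)
    assume ne: "V \<inter> \<Inter>U \<noteq> {}"
    have "V \<inter> \<Inter>U = V"
    proof (rule no_invariant_convD[OF nc _ ne])
      show "conv (V \<inter> \<Inter>U)" by (rule conv_Inter) (use conv_half_tree U1 in blast)
      fix g assume g: "g \<in> G"
      show "g ` (V \<inter> \<Inter>U) \<subseteq> V \<inter> \<Inter>U"
      proof
        fix z assume "z \<in> g ` (V \<inter> \<Inter>U)"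
        then obtain v where v: "z = g v" "v \<in> V" "\<And>Z. Z \<in> U \<Longrightarrow> v \<in> Z" by blast
        have "z \<in> Z" if Z: "Z \<in> U" for Z
        proof -
          have "v \<in> (inv\<^bsub>A\<^esub> g) ` Z" by (rule v(3)[OF inv[OF subgroup.m_inv_closed[OF G g] Z]])
          then have "z \<in> g ` (inv\<^bsub>A\<^esub> g) ` Z" using v by blast
          then show ?thesis using image_inv[OF GA[OF g] half_tree_subset[OF U1[OF Z]]] by simp
        qed
        then show "z \<in> V \<inter> \<Inter>U" using v aut_in[OF GA[OF g]] by simp
      qed
    qed
    moreover obtain Y where Y: "Y \<in> U" using U by blast
    ultimately show False using half_tree_proper[OF U1[OF Y]] half_tree_subset[OF U1[OF Y]] by blast
  qed
  \<comment> \<open>A member of \<open>U\<close> that misses \<open>v\<close> lies in a single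
    branch at \<open>v\<close>. The complement of this branch is disjoint from that member, so
    \<open>U\<close> must choose the branch.\<close>
  have "\<exists>w. (v, w) \<in> E \<and> hs v w \<in> U" if v: "v \<in> V" for v
  proof -
    obtain Y where Y: "Y \<in> U" "v \<notin> Y" using empty v by blast
    obtain u where u: "u \<in> Y" using half_tree_nonempty[OF U1[OF Y(1)]] by blast
    have "u \<in> V" "u \<noteq> v" using u Y half_tree_subset[OF U1[OF Y(1)]] by auto
    then obtain w where w: "(v, w) \<in> E" "u \<in> hs v w" using toward[OF v] by blast
    have "Y \<subseteq> hs v w"
      using conv_on_one_side[OF w(1) conv_half_tree[OF U1[OF Y(1)]]] Y u w hs_disjoint[OF w(1)]
      by blast
    then have "hs w v \<notin> U" using U3[OF Y(1), of "hs w v"] hs_disjoint[OF w(1)] by blast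
    then show ?thesis using U2[OF w(1)] w by blast
  qed
  then obtain f where f1: "\<And>v. v \<in> V \<Longrightarrow> (v, f v) \<in> E"
    and f2: "\<And>v. v \<in> V \<Longrightarrow> hs v (f v) \<in> U" by metis
  have f3: "w = f v" if "(v, w) \<in> E" "hs v w \<in> U" for v w
    using hs_neighbour_disjoint[OF that(1) f1] U3[OF that(2) f2] edge_V[OF that(1)] by blast
  have fV: "f v \<in> V" if "v \<in> V" for v using f1[OF that] edge_V by blast
  have f_equiv: "f (g v) = g (f v)" if g: "g \<in> G" and v: "v \<in> V" for g v
    using f3[OF aut_edge[OF GA[OF g] f1[OF v]]] aut_hs[OF GA[OF g] f1[OF v]] inv[OF g f2[OF v]]
    by simp
  have itV: "(f ^^ n) v \<in> V" if "v \<in> V" for n v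
    by (induction n) (use that fV in auto)
  have it_equiv: "(f ^^ n) (g v) = g ((f ^^ n) v)" if g: "g \<in> G" and v: "v \<in> V" for n g v
    by (induction n) (use f_equiv[OF g itV[OF v]] in auto)
  \<comment> \<open>\<open>U\<close> chooses a side of every edge, so every edge is a step of
    \<open>f\<close> in one direction; connectedness then merges the orbits.\<close>
  have adj: "f u = v \<or> f v = u" if "(u, v) \<in> E" for u v
    using U2[OF that] f3[OF that] f3[OF edge_sym[OF that]] by auto
  have merge: "\<exists>m n. (f ^^ m) u = (f ^^ n) v" if u: "u \<in> V" and v: "v \<in> V" for u v
    using connected[OF u v]
  proof (induction rule: rtrancl_induct)
    case base
    show ?case by blast
  next
    case (step a b)
    then obtain m n where mn: "(f ^^ m) u = (f ^^ n) a" by blast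
    from adj[OF step.hyps(2)] show ?case
    proof
      assume "f a = b"
      then have "(f ^^ Suc m) u = (f ^^ n) b" using mn by (simp add: funpow_swap1)
      then show ?thesis by blast
    next
      assume "f b = a"
      then have "(f ^^ m) u = (f ^^ Suc n) b" using mn by (simp add: funpow_swap1)
      then show ?thesis by blast
    qed
  qed
  obtain v0 where v0: "v0 \<in> V" using tree by (auto simp: is_tree_def)
  define r where "r n = (f ^^ n) v0" for n
  have rV: "r n \<in> V" for n using itV[OF v0] by (simp add: r_def)
  have rS: "r (Suc n) = f (r n)" for n by (simp add: r_def)
  define D where "D n = hs (r n) (r (Suc n))" for n
  have DU: "D n \<in> U" for n using f2[OF rV] by (simp add: D_def rS)
  have re: "(r n, r (Suc n)) \<in> E" for n using f1[OF rV] by (simp add: rS)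
  \<comment> \<open>The ray does not turn back, since the members \<open>D n\<close> and
    \<open>D (Suc n)\<close> of \<open>U\<close> meet. The nested half-trees then make it injective:
    \<open>D m\<close> contains all vertices of the ray after \<open>r m\<close>, but not
    \<open>r m\<close>.\<close>
  have "D (Suc n) \<subseteq> D n" for n
  proof -
    have "r (Suc (Suc n)) \<noteq> r n"
      using U3[OF DU[of "Suc n"] DU[of n]] hs_disjoint[OF re[of n]] unfolding D_def by auto
    then show ?thesis
      using hs_neighbour_disjoint[OF re[of "Suc n"] edge_sym[OF re[of n]]]
        hs_cover[OF re[of n]] hs_subset unfolding D_def by blast
  qed
  then have Dmono: "m \<le> n \<Longrightarrow> D n \<subseteq> D m" for m n by (rule lift_Suc_antimono_le)
  have "r m \<noteq> r n" if "m < n" for m n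
  proof -
    obtain k where k: "n = Suc k" "m \<le> k" using less_imp_Suc_add[OF \<open>m < n\<close>] by auto
    have "r n \<in> D m" using Dmono[OF k(2)] in_hs[OF re[of k]] k(1) unfolding D_def by blast
    moreover have "r m \<notin> D m" using notin_hs[OF re] unfolding D_def .
    ultimately show ?thesis by auto
  qed
  then have "inj r" by (rule linorder_injI)
  then have ray: "r \<in> rays E" using re by (simp add: rays_def)
  define \<xi> where "\<xi> = cofinal_rays E `` {r}"
  have "\<xi> \<in> tree_ends E" unfolding \<xi>_def tree_ends_def by (rule quotientI[OF ray])
  have raysV: "s n \<in> V" if "s \<in> rays E" for s n using that edge_V unfolding rays_def by blast
  have sub: "g \<circ> s \<in> \<xi>" if g: "g \<in> G" and s: "s \<in> \<xi>" for g s
  proof -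
    obtain m n where s1: "s \<in> rays E" and mn: "\<And>k. r (m + k) = s (n + k)"
      using s unfolding \<xi>_def cofinal_rays_def by auto
    have "inj (g \<circ> s)"
      using s1 aut_eq_iff[OF GA[OF g] raysV[OF s1] raysV[OF s1]]
      unfolding rays_def inj_def by auto
    then have gs: "g \<circ> s \<in> rays E" using s1 aut_edge[OF GA[OF g]] unfolding rays_def by auto
    \<comment> \<open>The orbits of \<open>v0\<close> and \<open>g v0\<close> merge after
      \<open>a\<close> and \<open>b\<close> steps, and the second is the image of \<open>r\<close>
      under \<open>g\<close>.\<close>
    obtain a b where ab: "(f ^^ a) v0 = (f ^^ b) (g v0)"
      using merge[OF v0 aut_in[OF GA[OF g] v0]] by blast
    have shift: "r (a + j) = g (r (b + j))" for j
    proof -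
      have "r (a + j) = (f ^^ j) ((f ^^ a) v0)" by (simp add: r_def add.commute[of a] funpow_add)
      also have "\<dots> = (f ^^ (j + b)) (g v0)" by (simp add: ab funpow_add)
      also have "\<dots> = g (r (b + j))" by (simp add: r_def it_equiv[OF g v0] add.commute)
      finally show ?thesis .
    qed
    have "r (a + m + k) = (g \<circ> s) (n + b + k)" for k
      using shift[of "m + k"] mn[of "b + k"] by (simp add: add.assoc add.left_commute)
    then show ?thesis using ray gs unfolding \<xi>_def cofinal_rays_def by blast
  qed
  have "(\<lambda>s. g \<circ> s) ` \<xi> = \<xi>" if g: "g \<in> G" for g
  proof
    show "(\<lambda>s. g \<circ> s) ` \<xi> \<subseteq> \<xi>" using sub[OF g] by blast
    show "\<xi> \<subseteq> (\<lambda>s. g \<circ> s) ` \<xi>"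
    proof
      fix s assume s: "s \<in> \<xi>"
      then have "s \<in> rays E" unfolding \<xi>_def cofinal_rays_def by auto
      then have "s = g \<circ> (inv\<^bsub>A\<^esub> g \<circ> s)" using apply_inv[OF GA[OF g] raysV] by auto
      then show "s \<in> (\<lambda>s. g \<circ> s) ` \<xi>"
        using sub[OF subgroup.m_inv_closed[OF G g] s] by blast
    qed
  qed
  then show ?thesis using \<open>\<xi> \<in> tree_ends E\<close> unfolding fixes_end_def by blast
qed

text \<open>An edge forces orientations to be nonempty; in a one-vertex tree the empty family would
  be an invariant orientation.\<close>

lemma geometrically_dense_dense_action:
  assumes G: "subgroup G A" and gd: "geometrically_dense V E G" and "E \<noteq> {}"
  shows "dense_action G"
proof -
  have nc: "no_invariant_conv G" by (rule geometrically_dense_no_invariant_conv[OF G gd])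
  have "U \<noteq> {}" if "orientation U" for U
    using that \<open>E \<noteq> {}\<close> unfolding orientation_def by (metis empty_iff equals0I surj_pair)
  then have "no_invariant_orientation G"
    using invariant_orientation_fixes_end[OF G nc] gd
    unfolding no_invariant_orientation_def geometrically_dense_def by metis
  then show ?thesis using nc by (simp add: dense_action_def)
qed

text \<open>The edge bounding \<open>Y\<close> is fixed pointwise, and fixedness spreads: a fixed
  vertex with one fixed neighbour has at most one other neighbour.\<close>

lemma rist_not_branching:
  assumes nb: "\<not> branching" and Y: "Y \<in> half_trees V E" and GA: "G \<subseteq> carrier A"
    and a: "a \<in> rist V G Y"
  shows "a = \<one>\<^bsub>A\<^esub>"
proof -
  have aA: "a \<in> carrier A" and fixed: "\<And>v. v \<in> V \<Longrightarrow> v \<notin> Y \<Longrightarrow> a v = v"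
    using a GA by (auto simp: rist_def)
  obtain x y where xy: "(x, y) \<in> E" "Y = hs x y" using Y by (rule half_treeE)
  have V: "x \<in> V" "y \<in> V" using edge_V xy by auto
  have ax: "a x = x" using fixed V notin_hs xy by blast
  have e: "(x, a y) \<in> E" using aut_edge[OF aA xy(1)] ax by simp
  \<comment> \<open>If \<open>a\<close> moved \<open>y\<close>, the image would be a neighbour of
    \<open>x\<close> outside \<open>Y\<close>, hence fixed, against injectivity.\<close>
  have ay: "a y = y"
  proof (rule ccontr)
    assume ne: "a y \<noteq> y"
    then have "a y \<notin> Y" using hs_exit[OF xy(1) _ edge_sym[OF e]] notin_hs xy by blast
    then have "a (a y) = a y" using fixed edge_V[OF e] by blast
    then show False using ne aut_eq_iff[OF aA] edge_V[OF e] V by blast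
  qed
  have "a w = w \<and> (\<exists>u. (w, u) \<in> E \<and> a u = u)" if w: "w \<in> V" for w
    using connected[OF V(1) w]
  proof (induction rule: rtrancl_induct)
    case base
    show ?case using ax ay xy by blast
  next
    case (step w z)
    then obtain u where u: "(w, u) \<in> E" "a u = u" "a w = w" by blast
    have "a z = z"
    proof (cases "z = u")
      case True
      then show ?thesis using u by simp
    next
      case False
      have "(w, a z) \<in> E" using aut_edge[OF aA step.hyps(2)] u by simp
      moreover have "a z \<noteq> u"
        using False u aut_eq_iff[OF aA, of z u] edge_V[OF step.hyps(2)] edge_V[OF u(1)] by auto
      ultimately show ?thesis using nb False u step.hyps(2) unfolding branching_def by auto
    qed
    then show ?case using u edge_sym[OF step.hyps(2)] by blast
  qed
  then show ?thesis by (intro aut_eqI) (use aA one_apply in auto)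
qed

section \<open>The commutator trick\<close>

lemma support_stable:
  assumes g: "g \<in> carrier A" and fixed: "\<And>v. v \<in> V \<Longrightarrow> v \<notin> D \<Longrightarrow> g v = v"
    and v: "v \<in> V" "v \<in> D"
  shows "g v \<in> D"
proof (rule ccontr)
  assume n: "g v \<notin> D"
  then have "g (g v) = g v" using fixed[OF aut_in[OF g v(1)]] by blast
  then have "g v = v" using aut_eq_iff[OF g aut_in[OF g v(1)] v(1)] by blast
  then show False using n v by simp
qed

text \<open>Each vertex is moved by at most one factor, so the partial products are eventually
  constant at every vertex. They converge in the permutation topology, and closedness puts the limit
  into \<open>G\<close>. Injectivity and adjacency concern two vertices at a time, where the limit
  agrees with a partial product.\<close>

lemma infinite_product:
  assumes G: "subgroup G A" and cl: "closedin (perm_topology V E) G"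
    and a: "\<And>j. a j \<in> G"
    and supp: "\<And>j v. v \<in> V \<Longrightarrow> v \<notin> D j \<Longrightarrow> a j v = v"
    and disj: "\<And>i j v. v \<in> D i \<Longrightarrow> v \<in> D j \<Longrightarrow> i = (j :: nat)"
  obtains b where "b \<in> G" "\<And>j v. v \<in> V \<Longrightarrow> v \<in> D j \<Longrightarrow> b v = a j v"
    "\<And>v. v \<in> V \<Longrightarrow> (\<And>j. v \<notin> D j) \<Longrightarrow> b v = v"
proof -
  have GA: "g \<in> carrier A" if "g \<in> G" for g using subgroup.mem_carrier[OF G that] .
  note aA = GA[OF a]
  define c where "c = rec_nat \<one>\<^bsub>A\<^esub> (\<lambda>m x. x \<otimes>\<^bsub>A\<^esub> a m)"
  have c0: "c 0 = \<one>\<^bsub>A\<^esub>" and cS: "c (Suc m) = c m \<otimes>\<^bsub>A\<^esub> a m" for m by (simp_all add: c_def)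
  have cG: "c m \<in> G" for m
    by (induction m) (use G a in \<open>simp_all add: c0 cS subgroup.one_closed subgroup.m_closed\<close>)
  note cA = GA[OF cG]
  have cSv: "c (Suc m) v = c m (a m v)" if "v \<in> V" for m v
    using mult_apply[OF cA aA that] by (simp add: cS)
  have c_fix: "c m v = v" if "v \<in> V" "\<And>j. j < m \<Longrightarrow> v \<notin> D j" for m v
    using that(2)
  proof (induction m)
    case 0
    show ?case using one_apply[OF that(1)] by (simp add: c0)
  next
    case (Suc m)
    have "a m v = v" using supp[OF that(1)] Suc.prems by blast
    then show ?case using Suc cSv[OF that(1)] by simp
  qed
  \<comment> \<open>The rightmost factor acts first: later factors fix \<open>v\<close>, then factor
    \<open>j\<close> moves it inside \<open>D j\<close>, where earlier factors fix it.\<close>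
  have c_eval: "c m v = a j v" if v: "v \<in> V" "v \<in> D j" and "j < m" for m j v
    using \<open>j < m\<close>
  proof (induction m)
    case 0
    then show ?case by simp
  next
    case (Suc m)
    show ?case
    proof (cases "j = m")
      case True
      have m: "a m v \<in> D m" using support_stable[OF aA supp v(1)] v True by blast
      have "c m (a m v) = a m v"
        by (rule c_fix[OF aut_in[OF aA v(1)]]) (use disj m in fastforce)
      then show ?thesis using cSv[OF v(1)] True by simp
    next
      case False
      have "a m v = v" using supp[OF v(1)] disj[OF v(2)] False by blast
      then show ?thesis using cSv[OF v(1)] Suc False by simp
    qed
  qed
  \<comment> \<open>The restricted lambda makes \<open>b\<close> extensional, as \<open>Bij\<close>
    demands.\<close>
  define b where "b = (\<lambda>v \<in> V. if \<exists>j. v \<in> D j then a (THE j. v \<in> D j) v else v)"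
  have b1: "b v = a j v" if "v \<in> V" "v \<in> D j" for v j
  proof -
    have "(THE j. v \<in> D j) = j" using that disj by blast
    then show ?thesis using that by (auto simp: b_def)
  qed
  have b2: "b v = v" if "v \<in> V" "\<And>j. v \<notin> D j" for v using that by (simp add: b_def)
  have out: "\<exists>M. \<forall>j\<ge>M. v \<notin> D j" for v
  proof (cases "\<exists>j. v \<in> D j")
    case True
    then obtain j where "v \<in> D j" by blast
    then have "\<forall>i\<ge>Suc j. v \<notin> D i" using disj by fastforce
    then show ?thesis by blast
  qed blast
  have stable: "b v = c m v" if "v \<in> V" "\<And>j. j \<ge> m \<Longrightarrow> v \<notin> D j" for m v
  proof (cases "\<exists>j. v \<in> D j")
    case True
    then obtain j where j: "v \<in> D j" by blast
    then have "j < m" using that(2)[of j] by (meson not_less)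
    then show ?thesis using b1[OF that(1) j] c_eval[OF that(1) j] by simp
  next
    case False
    then show ?thesis using b2[OF that(1)] c_fix[OF that(1)] by simp
  qed
  have ev: "\<exists>M. \<forall>m\<ge>M. b v = c m v" if "v \<in> V" for v
  proof -
    obtain M where "\<forall>j\<ge>M. v \<notin> D j" using out by blast
    then show ?thesis using stable[OF that] by (meson order_trans)
  qed
  have ev2: "\<exists>m. b v = c m v \<and> b w = c m w" if v: "v \<in> V" and w: "w \<in> V" for v w
  proof -
    obtain M M' where "\<forall>m\<ge>M. b v = c m v" "\<forall>m\<ge>M'. b w = c m w"
      using ev[OF v] ev[OF w] by blast
    then show ?thesis by (intro exI[of _ "max M M'"]) simp
  qed
  have bV: "b v \<in> V" if "v \<in> V" for v using ev2[OF that that] aut_in[OF cA that] by auto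
  \<comment> \<open>Choose \<open>M\<close> beyond every index whose support contains
    \<open>w\<close> and pull \<open>w\<close> back along \<open>c M\<close>. A preimage in some
    later support would be fixed by \<open>c M\<close>, hence equal to \<open>w\<close>, against the
    choice of \<open>M\<close>; so \<open>b\<close> and \<open>c M\<close> agree there.\<close>
  have surj: "\<exists>v \<in> V. b v = w" if w: "w \<in> V" for w
  proof -
    obtain M where M: "\<forall>j\<ge>M. w \<notin> D j" using out by blast
    obtain v where v: "v \<in> V" "w = c M v" by (rule aut_surj[OF cA w])
    have "v \<notin> D j" if "j \<ge> M" for j
    proof
      assume j: "v \<in> D j"
      have "c M v = v" by (rule c_fix[OF v(1)]) (use disj[OF j] that in fastforce)
      then show False using M j that v by simp
    qed
    then show ?thesis using stable[OF v(1)] v by auto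
  qed
  have "inj_on b V"
  proof (rule inj_onI)
    fix v w assume vw: "v \<in> V" "w \<in> V" "b v = b w"
    then obtain m where "c m v = c m w" using ev2[OF vw(1,2)] by metis
    then show "v = w" using aut_eq_iff[OF cA] vw by blast
  qed
  moreover have "b ` V = V" using bV surj by (auto simp: image_iff)
  moreover have "b \<in> extensional V" by (simp add: b_def)
  ultimately have bB: "b \<in> Bij V" by (simp add: Bij_def bij_betw_def)
  have "(b v, b w) \<in> E \<longleftrightarrow> (v, w) \<in> E" if "v \<in> V" "w \<in> V" for v w
    using ev2[OF that] aut_edge_iff[OF cA that] by metis
  then have b_aut: "b \<in> tree_auts V E" using bB by (simp add: tree_auts_def)
  have "limitin (perm_topology V E) c b sequentially"
    unfolding perm_topology_def limitin_subtopology limitin_componentwise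
  proof (intro conjI ballI)
    show "b \<in> tree_auts V E" by (rule b_aut)
    show "\<forall>\<^sub>F m in sequentially. c m \<in> tree_auts V E" using cA by (simp add: carrier_A)
    show "b \<in> extensional V" by (simp add: b_def)
    show "\<forall>\<^sub>F m in sequentially. c m \<in> topspace (product_topology (\<lambda>_. discrete_topology V) V)"
    proof -
      have "c m \<in> extensional V" for m
        using cA[of m] by (simp add: carrier_A tree_auts_def Bij_def)
      then have "c m \<in> V \<rightarrow>\<^sub>E V" for m using aut_in[OF cA] by (simp add: PiE_def)
      then show ?thesis by simp
    qed
    fix v assume v: "v \<in> V"
    show "limitin (discrete_topology V) (\<lambda>m. c m v) (b v) sequentially"
    proof (rule limitin_eventually)
      show "b v \<in> topspace (discrete_topology V)" using bV v by simp
      show "\<forall>\<^sub>F m in sequentially. c m v = b v"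
        using ev[OF v] unfolding eventually_sequentially by metis
    qed
  qed
  then have "b \<in> G" by (rule limitin_closedin[OF _ cl]) (simp_all add: cG)
  then show thesis using that b1 b2 by blast
qed

text \<open>Conjugation by \<open>n\<close> shifts the factors by one index, so it turns
  \<open>b\<close> into the same product without its factor \<open>a\<close> of index 0. Solving for
  \<open>a\<close> gives a commutator of \<open>b\<close> and \<open>n\<close>, and \<open>b\<close>
  lies in the rigid stabiliser of \<open>Z\<close>, which normalises \<open>N\<close>.\<close>

lemma rist_subset_normal:
  assumes G: "subgroup G A" and cl: "closedin (perm_topology V E) G" and N: "subgroup N A"
    and norm: "\<And>b m. b \<in> rist V G Z \<Longrightarrow> m \<in> N \<Longrightarrow> b \<otimes>\<^bsub>A\<^esub> m \<otimes>\<^bsub>A\<^esub> inv\<^bsub>A\<^esub> b \<in> N"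
    and n: "n \<in> N" "n \<in> G" "n ` Z \<subseteq> Z"
    and Y: "Y \<subseteq> Z" "Y \<inter> n ` Z = {}" and Z: "Z \<subseteq> V"
    and a: "a \<in> rist V G Y"
  shows "a \<in> N"
proof -
  have GA: "g \<in> carrier A" if "g \<in> G" for g using subgroup.mem_carrier[OF G that] .
  have aG: "a \<in> G" and a_fix: "\<And>v. v \<in> V \<Longrightarrow> v \<notin> Y \<Longrightarrow> a v = v" using a by (auto simp: rist_def)
  note aA = GA[OF aG] and nA = GA[OF n(2)]
  have YV: "Y \<subseteq> V" using Y Z by blast
  define p where "p j = n [^]\<^bsub>A\<^esub> j" for j :: nat
  have pS: "p (Suc j) = p j \<otimes>\<^bsub>A\<^esub> n" for j by (simp add: p_def)
  have pS2: "p (Suc j) = n \<otimes>\<^bsub>A\<^esub> p j" for j unfolding p_def by (rule A.nat_pow_Suc2[OF nA])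
  have p0: "p 0 = \<one>\<^bsub>A\<^esub>" by (simp add: p_def)
  have pG: "p j \<in> G" for j
    by (induction j) (use G n in \<open>simp_all add: p0 pS subgroup.one_closed subgroup.m_closed\<close>)
  note pA = GA[OF pG]
  define D where "D j = p j ` Y" for j
  define \<alpha> where "\<alpha> j = p j \<otimes>\<^bsub>A\<^esub> a \<otimes>\<^bsub>A\<^esub> inv\<^bsub>A\<^esub> (p j)" for j
  have \<alpha>G: "\<alpha> j \<in> G" for j
    unfolding \<alpha>_def using G pG aG by (simp add: subgroup.m_closed subgroup.m_inv_closed)
  have \<alpha>v: "\<alpha> j v = p j (a ((inv\<^bsub>A\<^esub> (p j)) v))" if v: "v \<in> V" for j v
    unfolding \<alpha>_def using pA[of j] aA v aut_in by (simp add: mult_apply)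
  have D_iff: "v \<in> D j \<longleftrightarrow> (inv\<^bsub>A\<^esub> (p j)) v \<in> Y" if v: "v \<in> V" for j v
    using aut_mem_image[OF pA[of j] YV aut_in[OF A.inv_closed[OF pA[of j]] v]] apply_inv[OF pA[of j] v]
    unfolding D_def by simp
  have \<alpha>_fix: "\<alpha> j v = v" if v: "v \<in> V" "v \<notin> D j" for j v
    using \<alpha>v[OF v(1)] a_fix[OF aut_in[OF A.inv_closed[OF pA] v(1)]] D_iff[OF v(1)] v
      apply_inv[OF pA v(1)] by simp
  have zS: "p (Suc j) ` Z = p j ` n ` Z" for j unfolding pS by (rule mult_image[OF pA nA Z])
  have "p (Suc j) ` Z \<subseteq> p j ` Z" for j unfolding zS by (rule image_mono[OF n(3)])
  then have mono: "i \<le> j \<Longrightarrow> p j ` Z \<subseteq> p i ` Z" for i j by (rule lift_Suc_antimono_le)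
  have DZ: "D j \<subseteq> p j ` Z" for j unfolding D_def by (rule image_mono[OF Y(1)])
  \<comment> \<open>The images of \<open>Z\<close> under the powers of \<open>n\<close> decrease,
    and \<open>D j\<close> lies in the layer between two consecutive ones; distinct layers are
    disjoint.\<close>
  have "D j \<inter> p (Suc j) ` Z = {}" for j
    unfolding D_def zS using aut_image_Int[OF pA YV, of "n ` Z"] Y n(3) Z by simp
  then have "v \<notin> D j" if "v \<in> D i" "i < j" for i j v
    using that DZ[of j] mono[of "Suc i" j] by (meson Suc_leI disjoint_iff subsetD)
  then have disj: "i = j" if "v \<in> D i" "v \<in> D j" for i j v
    using that by (meson nat_neq_iff)
  obtain b where b: "b \<in> G" "\<And>j v. v \<in> V \<Longrightarrow> v \<in> D j \<Longrightarrow> b v = \<alpha> j v"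
    "\<And>v. v \<in> V \<Longrightarrow> (\<And>j. v \<notin> D j) \<Longrightarrow> b v = v"
    by (rule infinite_product[OF G cl, of \<alpha> D]) (use \<alpha>G \<alpha>_fix disj in blast)+
  note bA = GA[OF b(1)]
  have p0Z: "p 0 ` W = W" if "W \<subseteq> V" for W using one_image[OF that] by (simp add: p0)
  have D0: "D 0 = Y" unfolding D_def by (rule p0Z[OF YV])
  have "D j \<subseteq> Z" for j using DZ[of j] mono[of 0 j] p0Z[OF Z] by auto
  then have bZ: "b \<in> rist V G Z" using b unfolding rist_def by blast
  have \<alpha>0: "\<alpha> 0 = a" using aA by (simp add: \<alpha>_def p0)
  have \<alpha>S: "\<alpha> (Suc j) = n \<otimes>\<^bsub>A\<^esub> \<alpha> j \<otimes>\<^bsub>A\<^esub> inv\<^bsub>A\<^esub> n" for j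
    unfolding \<alpha>_def pS2 using nA pA[of j] aA by (simp add: A.inv_mult_group A.m_assoc)
  have DS: "n w \<in> D (Suc j) \<longleftrightarrow> w \<in> D j" if w: "w \<in> V" for w j
  proof -
    have "D (Suc j) = n ` D j" unfolding D_def pS2 by (rule mult_image[OF nA pA YV])
    moreover have "D j \<subseteq> V" unfolding D_def by (rule aut_image_subset[OF pA YV])
    ultimately show ?thesis using aut_mem_image[OF nA _ w] by simp
  qed
  have eq: "a \<otimes>\<^bsub>A\<^esub> (n \<otimes>\<^bsub>A\<^esub> b \<otimes>\<^bsub>A\<^esub> inv\<^bsub>A\<^esub> n) = b"
  proof (rule aut_eqI)
    show "a \<otimes>\<^bsub>A\<^esub> (n \<otimes>\<^bsub>A\<^esub> b \<otimes>\<^bsub>A\<^esub> inv\<^bsub>A\<^esub> n) \<in> carrier A" using aA nA bA by simp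
    show "b \<in> carrier A" by (rule bA)
    fix v assume v: "v \<in> V"
    define w where "w = (inv\<^bsub>A\<^esub> n) v"
    have w: "w \<in> V" "n w = v"
      unfolding w_def using aut_in[OF A.inv_closed[OF nA] v] apply_inv[OF nA v] by auto
    have lhs: "(a \<otimes>\<^bsub>A\<^esub> (n \<otimes>\<^bsub>A\<^esub> b \<otimes>\<^bsub>A\<^esub> inv\<^bsub>A\<^esub> n)) v = a (n (b w))"
      unfolding w_def using aA nA bA v aut_in by (simp add: mult_apply)
    \<comment> \<open>Membership of \<open>v\<close> in a shifted support is read off at its
      preimage \<open>w\<close>. If it holds, the moved vertex stays in \<open>D (Suc j)\<close>,
      off \<open>Y\<close>, where \<open>a\<close> is trivial; if not, only \<open>D 0\<close>, that
      is \<open>Y\<close>, can contain \<open>v\<close>.\<close>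
    show "(a \<otimes>\<^bsub>A\<^esub> (n \<otimes>\<^bsub>A\<^esub> b \<otimes>\<^bsub>A\<^esub> inv\<^bsub>A\<^esub> n)) v = b v"
    proof (cases "\<exists>j. w \<in> D j")
      case True
      then obtain j where j: "w \<in> D j" by blast
      then have vS: "v \<in> D (Suc j)" using DS[OF w(1)] w(2) by simp
      have "n (b w) = \<alpha> (Suc j) v"
        unfolding b(2)[OF w(1) j] \<alpha>S using nA GA[OF \<alpha>G[of j]] v aut_in
        by (simp add: mult_apply w_def)
      moreover have S: "\<alpha> (Suc j) v \<in> D (Suc j)"
        by (rule support_stable[OF GA[OF \<alpha>G] \<alpha>_fix v vS])
      have "\<alpha> (Suc j) v \<notin> Y" using disj[OF S, of 0] D0 by auto
      ultimately show ?thesis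
        using lhs b(2)[OF v vS] a_fix[OF aut_in[OF GA[OF \<alpha>G] v]] by simp
    next
      case False
      then have l: "(a \<otimes>\<^bsub>A\<^esub> (n \<otimes>\<^bsub>A\<^esub> b \<otimes>\<^bsub>A\<^esub> inv\<^bsub>A\<^esub> n)) v = a v"
        using lhs b(3)[OF w(1)] w(2) by simp
      show ?thesis
      proof (cases "v \<in> Y")
        case True
        then show ?thesis using l b(2)[OF v, of 0] D0 \<alpha>0 by simp
      next
        case nY: False
        have "v \<notin> D j" for j
          using nY False DS[OF w(1)] w(2) D0 by (cases j) auto
        then show ?thesis using l b(3)[OF v] a_fix[OF v nY] by simp
      qed
    qed
  qed
  have "a = b \<otimes>\<^bsub>A\<^esub> inv\<^bsub>A\<^esub> (n \<otimes>\<^bsub>A\<^esub> b \<otimes>\<^bsub>A\<^esub> inv\<^bsub>A\<^esub> n)"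
    using A.inv_solve_right[of a b "n \<otimes>\<^bsub>A\<^esub> b \<otimes>\<^bsub>A\<^esub> inv\<^bsub>A\<^esub> n"] eq aA nA bA by simp
  also have "\<dots> = (b \<otimes>\<^bsub>A\<^esub> n \<otimes>\<^bsub>A\<^esub> inv\<^bsub>A\<^esub> b) \<otimes>\<^bsub>A\<^esub> inv\<^bsub>A\<^esub> n"
    using nA bA by (simp add: A.inv_mult_group A.m_assoc)
  finally show ?thesis
    using subgroup.m_closed[OF N norm[OF bZ n(1)] subgroup.m_inv_closed[OF N n(1)]] by simp
qed

section \<open>Normality of the generated group and assembly of the argument\<close>

lemma normal_in_subgroup:
  assumes H: "subgroup H A" and N: "N \<lhd> A\<lparr>carrier := H\<rparr>"
  shows "subgroup N A" "N \<subseteq> H"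
    "\<And>h n. h \<in> H \<Longrightarrow> n \<in> N \<Longrightarrow> h \<otimes>\<^bsub>A\<^esub> n \<otimes>\<^bsub>A\<^esub> inv\<^bsub>A\<^esub> h \<in> N"
proof -
  have sub: "subgroup N (A\<lparr>carrier := H\<rparr>)" by (rule normal_imp_subgroup[OF N])
  show "subgroup N A" by (rule A.incl_subgroup[OF H sub])
  show "N \<subseteq> H" using subgroup.subset[OF sub] by simp
  show "h \<otimes>\<^bsub>A\<^esub> n \<otimes>\<^bsub>A\<^esub> inv\<^bsub>A\<^esub> h \<in> N" if "h \<in> H" "n \<in> N" for h n
    using normal.inv_op_closed2[OF N, of h n] that A.m_inv_consistent[OF H] by simp
qed

lemma rist_conj:
  assumes G: "subgroup G A" and Y: "Y \<subseteq> V" and g: "g \<in> G" and a: "a \<in> rist V G Y"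
  shows "g \<otimes>\<^bsub>A\<^esub> a \<otimes>\<^bsub>A\<^esub> inv\<^bsub>A\<^esub> g \<in> rist V G (g ` Y)"
proof -
  have aG: "a \<in> G" and a_fix: "\<And>v. v \<in> V \<Longrightarrow> v \<notin> Y \<Longrightarrow> a v = v" using a by (auto simp: rist_def)
  have gA: "g \<in> carrier A" and aA: "a \<in> carrier A" using subgroup.mem_carrier[OF G] g aG by auto
  have "(g \<otimes>\<^bsub>A\<^esub> a \<otimes>\<^bsub>A\<^esub> inv\<^bsub>A\<^esub> g) v = v" if v: "v \<in> V" "v \<notin> g ` Y" for v
  proof -
    have w: "(inv\<^bsub>A\<^esub> g) v \<in> V" by (rule aut_in[OF A.inv_closed[OF gA] v(1)])
    have "(inv\<^bsub>A\<^esub> g) v \<notin> Y"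
      using aut_mem_image[OF gA Y w] apply_inv[OF gA v(1)] v by simp
    then show ?thesis
      using a_fix[OF w] apply_inv[OF gA v(1)] gA aA v(1) w by (simp add: mult_apply)
  qed
  moreover have "g \<otimes>\<^bsub>A\<^esub> a \<otimes>\<^bsub>A\<^esub> inv\<^bsub>A\<^esub> g \<in> G"
    using G g aG by (simp add: subgroup.m_closed subgroup.m_inv_closed)
  ultimately show ?thesis by (simp add: rist_def)
qed

text \<open>Conjugation by an element of \<open>G\<close> permutes the rigid stabilisers of
  half-trees, so the generating set is closed under it.\<close>

lemma plus_plus_normal:
  assumes G: "subgroup G A"
  shows "plus_plus V E G \<lhd> A\<lparr>carrier := G\<rparr>"
proof -
  let ?S = "\<Union>Y \<in> half_trees V E. rist V G Y"
  interpret K: group "A\<lparr>carrier := G\<rparr>" by (rule A.subgroup_imp_group[OF G])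
  have S: "?S \<subseteq> G" by (auto simp: rist_def)
  have "generate (A\<lparr>carrier := G\<rparr>) ?S \<lhd> A\<lparr>carrier := G\<rparr>"
  proof (rule K.normal_generateI)
    show "?S \<subseteq> carrier (A\<lparr>carrier := G\<rparr>)" using S by simp
    fix s g assume s: "s \<in> ?S" and "g \<in> carrier (A\<lparr>carrier := G\<rparr>)"
    then have g: "g \<in> G" by simp
    obtain Y where Y: "Y \<in> half_trees V E" "s \<in> rist V G Y" using s by blast
    have "g \<otimes>\<^bsub>A\<^esub> s \<otimes>\<^bsub>A\<^esub> inv\<^bsub>A\<^esub> g \<in> ?S"
      using rist_conj[OF G half_tree_subset[OF Y(1)] g Y(2)]
        aut_half_tree[OF subgroup.mem_carrier[OF G g] Y(1)] by blast
    then show "g \<otimes>\<^bsub>A\<lparr>carrier := G\<rparr>\<^esub> s \<otimes>\<^bsub>A\<lparr>carrier := G\<rparr>\<^esub> inv\<^bsub>A\<lparr>carrier := G\<rparr>\<^esub> g \<in> ?S"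
      using A.m_inv_consistent[OF G g] by simp
  qed
  then show ?thesis
    unfolding plus_plus_def using A.generate_consistent[OF S G] by simp
qed

text \<open>At a vertex \<open>v\<close> with three branches, \<open>Z0\<close> omits the first and
  contains the other two. Its image under \<open>n\<close> goes into the second, while the third
  makes room for a translate of \<open>Y\<close>.\<close>

lemma rist_subset_dense_normal:
  assumes G: "subgroup G A" and cl: "closedin (perm_topology V E) G"
    and N: "subgroup N A" "N \<subseteq> G" and d: "dense_action N" and br: branching
    and norm: "\<And>Z b m. Z \<in> half_trees V E \<Longrightarrow> b \<in> rist V G Z \<Longrightarrow> m \<in> N \<Longrightarrow>
      b \<otimes>\<^bsub>A\<^esub> m \<otimes>\<^bsub>A\<^esub> inv\<^bsub>A\<^esub> b \<in> N"
    and Y: "Y \<in> half_trees V E"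
  shows "rist V G Y \<subseteq> N"
proof
  fix a assume a: "a \<in> rist V G Y"
  have NA: "n \<in> carrier A" if "n \<in> N" for n using subgroup.mem_carrier[OF N(1) that] .
  obtain v w1 w2 w3 where w: "(v, w1) \<in> E" "(v, w2) \<in> E" "(v, w3) \<in> E"
    "w1 \<noteq> w2" "w1 \<noteq> w3" "w2 \<noteq> w3" using br unfolding branching_def by auto
  define Z0 where "Z0 = hs w1 v"
  have Z0: "Z0 \<in> half_trees V E" unfolding Z0_def by (rule half_tree_hs[OF edge_sym[OF w(1)]])
  have C2: "hs v w2 \<subseteq> Z0" and C3: "hs v w3 \<subseteq> Z0"
    using hs_neighbour_disjoint[OF w(1) w(2) w(4)] hs_neighbour_disjoint[OF w(1) w(3) w(5)]
      hs_cover[OF w(1)] hs_subset unfolding Z0_def by blast+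
  obtain n where n: "n \<in> N" "n ` Z0 \<subseteq> hs v w2"
    using translate_into[OF N(1) d Z0 half_tree_hs[OF w(2)]] by blast
  obtain h where h: "h \<in> N" "h ` Y \<subseteq> hs v w3"
    using translate_into[OF N(1) d Y half_tree_hs[OF w(3)]] by blast
  note hA = NA[OF h(1)]
  \<comment> \<open>Pulling back by \<open>k\<close> brings the configuration to \<open>Y\<close>
    itself: \<open>Z0\<close> becomes its image under \<open>k\<close>, and \<open>n\<close> becomes
    the conjugate \<open>m\<close>.\<close>
  define k where "k = inv\<^bsub>A\<^esub> h"
  have k: "k \<in> N" unfolding k_def by (rule subgroup.m_inv_closed[OF N(1) h(1)])
  note kA = NA[OF k]
  have Z0V: "Z0 \<subseteq> V" by (rule half_tree_subset[OF Z0])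

  define m where "m = k \<otimes>\<^bsub>A\<^esub> n \<otimes>\<^bsub>A\<^esub> inv\<^bsub>A\<^esub> k"
  have m: "m \<in> N" unfolding m_def
    using subgroup.m_inv_closed[OF N(1)] N(1) k n(1) by (simp add: subgroup.m_closed subgroup.m_inv_closed)
  have "inv\<^bsub>A\<^esub> k \<otimes>\<^bsub>A\<^esub> m \<otimes>\<^bsub>A\<^esub> k = n"
    unfolding m_def using kA NA[OF n(1)] by (simp add: A.m_assoc[symmetric]) (simp add: A.m_assoc)
  then have mZ: "m ` k ` Z0 = k ` n ` Z0" using conj_image[OF kA NA[OF m] Z0V] by simp
  have "k ` h ` Y \<subseteq> k ` hs v w3" by (rule image_mono[OF h(2)])
  then have Yk: "Y \<subseteq> k ` hs v w3"
    unfolding k_def using inv_image[OF hA half_tree_subset[OF Y]] by simp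
  show "a \<in> N"
  proof (rule rist_subset_normal[OF G cl N(1), where Z = "k ` Z0" and Y = Y and n = m])
    show "b \<otimes>\<^bsub>A\<^esub> l \<otimes>\<^bsub>A\<^esub> inv\<^bsub>A\<^esub> b \<in> N" if "b \<in> rist V G (k ` Z0)" "l \<in> N" for b l
      by (rule norm[OF aut_half_tree[OF kA Z0] that])
    show "m \<in> N" "m \<in> G" using m N by auto
    show "m ` k ` Z0 \<subseteq> k ` Z0" unfolding mZ using n(2) C2 by blast
    show "Y \<subseteq> k ` Z0" using Yk C3 by blast
    have "k ` hs v w3 \<inter> k ` hs v w2 = {}"
      using aut_image_Int[OF kA hs_subset hs_subset, of v w3 v w2]
        hs_neighbour_disjoint[OF w(2) w(3) w(6)] by (simp add: Int_commute)
    then show "Y \<inter> m ` k ` Z0 = {}" unfolding mZ using n(2) Yk by blast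
    show "k ` Z0 \<subseteq> V" by (rule aut_image_subset[OF kA Z0V])
    show "a \<in> rist V G Y" by (rule a)
  qed
qed

end

theorem corollary1p9:
  fixes V :: "'v set" and E :: "('v \<times> 'v) set" and G :: "('v \<Rightarrow> 'v) set"
  assumes "is_tree V E"
    and "subgroup G (Aut_tree V E)"
    and "closedin (perm_topology V E) G"
    and "locally_compact_space (subtopology (perm_topology V E) G)"
    and "geometrically_dense V E G"
  shows "plus_plus V E G = {\<one>\<^bsub>Aut_tree V E\<^esub>} \<or>
         abstractly_simple ((Aut_tree V E)\<lparr>carrier := plus_plus V E G\<rparr>)"
proof -
  interpret T: tree V E by (rule tree.intro[OF assms(1)])
  interpret A: group "Aut_tree V E" by (rule group_Aut_tree)
  note G = assms(2)
  define S where "S = (\<Union>Y \<in> half_trees V E. rist V G Y)"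
  define H where "H = plus_plus V E G"
  have H_def': "H = generate (Aut_tree V E) S" by (simp add: H_def plus_plus_def S_def)
  note H = T.normal_in_subgroup[OF G T.plus_plus_normal[OF G], folded H_def]
  show ?thesis
  \<comment> \<open>Without a branch vertex all generators are trivial, so the first alternative of
    the theorem holds.\<close>
  proof (cases "T.branching \<and> H \<noteq> {\<one>\<^bsub>Aut_tree V E\<^esub>}")
    case False
    have "H = {\<one>\<^bsub>Aut_tree V E\<^esub>}"
    proof (cases "T.branching")
      case nb: False
      have "S \<subseteq> {\<one>\<^bsub>Aut_tree V E\<^esub>}"
        using T.rist_not_branching[OF nb _ subgroup.subset[OF G]] unfolding S_def by blast
      then have "H \<subseteq> {\<one>\<^bsub>Aut_tree V E\<^esub>}"
        unfolding H_def' by (rule A.generate_subgroup_incl[OF _ A.triv_subgroup])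
      then show ?thesis using subgroup.one_closed[OF H(1)] by blast
    qed (use False in blast)
    then show ?thesis by (simp add: H_def)
  next
    case True
    then have br: "T.branching" and Hne: "H \<noteq> {\<one>\<^bsub>Aut_tree V E\<^esub>}" by auto
    have "E \<noteq> {}" using br unfolding T.branching_def by blast
    then have "T.dense_action G"
      by (rule T.geometrically_dense_dense_action[OF G assms(5)])
    \<comment> \<open>Density descends twice: from \<open>G\<close> to \<open>H\<close> here, and
      from \<open>H\<close> to \<open>N\<close> below.\<close>
    then have dH: "T.dense_action H" using T.normal_dense_action[OF G _ H(1) H(3) Hne br] by blast
    have "N = H \<or> N = {\<one>\<^bsub>Aut_tree V E\<^esub>}" if "N \<lhd> (Aut_tree V E)\<lparr>carrier := H\<rparr>" for N
    proof (rule disjCI)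
      assume Nne: "N \<noteq> {\<one>\<^bsub>Aut_tree V E\<^esub>}"
      note N = T.normal_in_subgroup[OF H(1) that]
      have dN: "T.dense_action N"
        using T.normal_dense_action[OF H(1) dH N(1) N(3) Nne br] by blast
      have SH: "S \<subseteq> H" unfolding H_def' by (blast intro: generate.incl)
      \<comment> \<open>\<open>N\<close> is normal in \<open>H\<close> only, which suffices because
        conjugation is by elements of rigid stabilisers, and these lie in \<open>H\<close>.\<close>
      have "rist V G Y \<subseteq> N" if Y: "Y \<in> half_trees V E" for Y
        by (rule T.rist_subset_dense_normal[OF G assms(3) N(1) _ dN br _ Y])
          (use N H SH S_def in blast)+
      then have "S \<subseteq> N" unfolding S_def by blast
      then have "H \<subseteq> N" unfolding H_def' by (rule A.generate_subgroup_incl[OF _ N(1)])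
      then show "N = H" using N(2) by blast
    qed
    then show ?thesis
      using Hne A.subgroup_imp_group[OF H(1)] unfolding abstractly_simple_def H_def by auto
  qed
qed

end
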